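(* In the setting of the context, consider the Riemann problem with two liquid states and assume the cavitation criterion is satisfied. Let $$f_z(p,\mathbf W_{L^-},\mathbf W_{L^+})=f_-(p,\mathbf W_{L^-})+f_+(p,\mathbf W_{L^+})+2z(p)\bigl(v_L(\varphi(p))-v_V(p)\bigr)+\Delta u,\qquad\Delta u=u_{L^+}-u_{L^-},$$ where $z(p)=p\,h(p,\varphi(p))$ and $$f_\pm(p,\mathbf W_{L^\pm})=\begin{cases}\sqrt{-(\varphi(p)-p_{L^\pm})(v_L(\varphi(p))-v_L(p_{L^\pm}))},&\varphi(p)>p_{L^\pm}\ \text{(shock)},\\[4pt]\displaystyle\int_{p_{L^\pm}}^{\varphi(p)}\frac{v_L(\zeta)}{a_L(\zeta)}\,\mathrm d\zeta,&\varphi(p)\le p_{L^\pm}\ \text{(rarefaction)}.\end{cases}$$ If there is a root $f_z(p^\ast,\mathbf W_{L^-},\mathbf W_{L^+})=0$ with $p_{min}\le p^\ast$ (and $p^\ast>0$ in the domain of $\varphi$), then this root is unique. Further, $p^\ast$ is the unique solution for the vapor pressure $p_V^\ast$ of the Riemann problem with phase transition. The vapor velocity $u_V^\ast$ is given by $$u_V^\ast=\tfrac12(u_{L^+}+u_{L^-})+\tfrac12\bigl(f_+(p^\ast,\mathbf W_{L^+})-f_-(p^\ast,\mathbf W_{L^-})\bigr).$$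
   Context: Thermodynamics. Two phases (vapor $V$, liquid $L$) of one substance at a fixed temperature. For $K\in\{V,L\}$, $v_K(p)>0$ is the specific volume as a (at least $C^2$) function of the pressure $p$, with $p\in(0,\infty)$ for $K=V$ and $p\in[p_{min},\infty)$ for $K=L$, where $p_{min}\le 0$ is the minimum liquid pressure; $\rho=1/v$ is the density. The sound speed $a_K(p)>0$ is defined by $v_K'=-v_K^2/a_K^2$; the Gibbs energy satisfies $g_K'=v_K$; the saturation pressure $p_0>0$ satisfies $g_L(p_0)=g_V(p_0)$. $\gamma_K=\frac{a_K^2}{p v_K}$, $\mathcal G_K=1+\frac{a_K}{v_K}a_K'$, and $\mathcal G_K>0$ is assumed. $v_K(p)\to0$ as $p\to\infty$, and $v_V(p)\to\infty$ as $p\to0^+$. $\tau>0$ is a constant. There are constants $\alpha\in(0,1)$, $\beta>0$ such that, with $\sigma_{max}=\frac{1+\sqrt{11-6\alpha}}2$, uniformly for $p_V\in(0,\sigma_{max}p_0]$, $p_L\in[p_{min},\infty)$: $0<\frac{v_L(p_L)}{v_V(p_V)}\le\alpha$, $0<\frac{v_L(p_L)a_V(p_V)}{v_V(p_V)a_L(p_L)}\le\alpha\beta<1$, $\tau(1-\alpha)^2a_V(p_V)^3<\gamma_V(p_V)$. With $\varepsilon(\gamma_V)=\frac1{\gamma_V}-1-\frac{\tau a_V^3}{\gamma_V^2}(1-\alpha)^2(1-(\alpha\beta)^2)$, one of the following holds (for these $p_V$ and all $p_L>0$): (I) $\gamma_V\le1\le\gamma_L$ and $\frac1{\gamma_L}\ge1+\frac{\varepsilon(\gamma_V)}\alpha$;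 or (II) $\gamma_V<1$, $\gamma_L<1$, $\alpha\le\frac{1-1/\gamma_V}{1-1/\gamma_L}$ and $\varepsilon(\gamma_V)\le0$. Interface. $h(p_V,p_L)=\tau\bigl[g_L(p_L)-g_V(p_V)-\frac12(p_L-p_V)(v_L(p_L)+v_V(p_V))\bigr]$. For $p\in(0,\sigma_{max}p_0]$, $\varphi(p)$ denotes the unique liquid pressure $q$ with $q-p+(p\,h(p,q))^2(v_L(q)-v_V(p))=0$ and $-\frac{a_V(p)}{v_V(p)}\le p\,h(p,q)\le\frac{a_L(q)}{v_L(q)}$. Riemann problem. Isothermal Euler equations $\partial_t\rho+\partial_x(\rho u)=0$, $\partial_t(\rho u)+\partial_x(\rho u^2+p)=0$, with initial liquid states $\mathbf W_{L^-}=(\rho_{L^-},u_{L^-})$ for $x<0$ and $\mathbf W_{L^+}=(\rho_{L^+},u_{L^+})$ for $x>0$, of pressures $p_{L^\pm}\ge p_{min}$. Across a discontinuity of speed $W$, with $[\![\Psi]\!]=\Psi^+-\Psi^-$ (right minus left) and $Z=-\rho(u-W)$: $[\![Z]\!]=0$, $-Z[\![u]\!]+[\![p]\!]=0$, and $Z[\![g+\tfrac12u^2]\!]\ge0$. Cavitation criterion: the function $F(p)=F_-(p)+F_+(p)+u_{L^+}-u_{L^-}$, where $F_\pm(p)=\sqrt{-(p-p_{L^\pm})(v_L(p)-v_L(p_{L^\pm}))}$ if $p>p_{L^\pm}$ and $F_\pm(p)=\int_{p_{L^\pm}}^p\frac{v_L(\zeta)}{a_L(\zeta)}\mathrm d\zeta$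 if $p\le p_{L^\pm}$, has no root $p\ge p_{min}$, i.e. there is no pure liquid solution. In that case a solution with phase transition is sought: a self-similar solution consisting of constant states separated by two classical waves (shocks or rarefaction waves inside one phase) and two phase boundaries enclosing a vapor state. At a phase boundary with vapor on the left the mass flux is $Z=\tau p_V[\,g_L-g_V+\frac12u_L^2-\frac12u_V^2]$ and with liquid on the left it is $Z=-\tau p_V[\,g_L-g_V+\frac12u_L^2-\frac12u_V^2]$, where the states adjacent to the boundary are inserted, and the quantity $\tau p_V[\cdots]$ lies in $[-a_V/v_V,a_L/v_L]$. The wave pattern from left to right is: $\mathbf W_{L^-}$, classical wave, liquid state, phase boundary, vapor state with pressure $p_V^\ast$ and velocity $u_V^\ast$, phase boundary, liquid state, classical wave, $\mathbf W_{L^+}$.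
   Formalization: In the entropy inequality and the kinetic relation, ½u² is read as ½(u−W)², relative to the discontinuity (the absolute form is not Galilean invariant and does not give h); uniqueness of the vapor pressure is among values in (0, σ_max p_0], where φ is defined. *)

theory Defs
  imports "HOL-Analysis.Analysis"
begin

section \<open>Thermodynamics of the two phases\<close>

text \<open>All quantities are functions of the pressure (the temperature is fixed): specific volume
  \<open>v\<close>, sound speed \<open>a\<close>, Gibbs energy \<open>g\<close>.\<close>

record phase =
  spec_vol :: "real \<Rightarrow> real"
  sound :: "real \<Rightarrow> real"
  gibbs :: "real \<Rightarrow> real"

record two_phase =
  vapor :: phase
  liquid :: phase
  pmin :: real
  psat :: real
  tau :: real

abbreviation vV :: "two_phase \<Rightarrow> real \<Rightarrow> real" where "vV E \<equiv> spec_vol (vapor E)"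
abbreviation vL :: "two_phase \<Rightarrow> real \<Rightarrow> real" where "vL E \<equiv> spec_vol (liquid E)"
abbreviation aV :: "two_phase \<Rightarrow> real \<Rightarrow> real" where "aV E \<equiv> sound (vapor E)"
abbreviation aL :: "two_phase \<Rightarrow> real \<Rightarrow> real" where "aL E \<equiv> sound (liquid E)"
abbreviation gV :: "two_phase \<Rightarrow> real \<Rightarrow> real" where "gV E \<equiv> gibbs (vapor E)"
abbreviation gL :: "two_phase \<Rightarrow> real \<Rightarrow> real" where "gL E \<equiv> gibbs (liquid E)"

definition C2_on :: "real set \<Rightarrow> (real \<Rightarrow> real) \<Rightarrow> bool" where
  "C2_on S f \<longleftrightarrow> (\<exists>f' f''.
     (\<forall>x\<in>S. (f has_real_derivative f' x) (at x within S)) \<and>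
     (\<forall>x\<in>S. (f' has_real_derivative f'' x) (at x within S)) \<and>
     continuous_on S f'')"

definition gam :: "phase \<Rightarrow> real \<Rightarrow> real" where
  "gam K p = (sound K p)\<^sup>2 / (p * spec_vol K p)"

text \<open>The fundamental derivative \<open>1 + (a / v) a'\<close>; the derivative is one-sided at an endpoint
  of the pressure domain \<open>S\<close>.\<close>

definition fund_deriv :: "phase \<Rightarrow> real set \<Rightarrow> real \<Rightarrow> real" where
  "fund_deriv K S p =
     1 + sound K p / spec_vol K p * vector_derivative (sound K) (at p within S)"

definition regular_phase :: "phase \<Rightarrow> real set \<Rightarrow> bool" where
  "regular_phase K S \<longleftrightarrow>
     C2_on S (spec_vol K) \<and>
     (\<forall>p\<in>S. spec_vol K p > 0 \<and> sound K p > 0 \<and>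
        (spec_vol K has_real_derivative - (spec_vol K p)\<^sup>2 / (sound K p)\<^sup>2) (at p within S) \<and>
        (gibbs K has_real_derivative spec_vol K p) (at p within S) \<and>
        fund_deriv K S p > 0) \<and>
     (spec_vol K \<longlongrightarrow> 0) at_top"

definition two_phase_fluid :: "two_phase \<Rightarrow> bool" where
  "two_phase_fluid E \<longleftrightarrow>
     pmin E \<le> 0 \<and> psat E > 0 \<and> tau E > 0 \<and>
     regular_phase (vapor E) {0<..} \<and>
     regular_phase (liquid E) {pmin E..} \<and>
     filterlim (vV E) at_top (at_right 0) \<and>
     gL E (psat E) = gV E (psat E)"

definition sigma_max :: "real \<Rightarrow> real" where
  "sigma_max \<alpha> = (1 + sqrt (11 - 6 * \<alpha>)) / 2"

definition vapor_range :: "two_phase \<Rightarrow> real \<Rightarrow> real set" where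
  "vapor_range E \<alpha> = {0<..sigma_max \<alpha> * psat E}"

definition eps :: "two_phase \<Rightarrow> real \<Rightarrow> real \<Rightarrow> real \<Rightarrow> real" where
  "eps E \<alpha> \<beta> p =
     1 / gam (vapor E) p - 1
     - tau E * aV E p ^ 3 / (gam (vapor E) p)\<^sup>2 * (1 - \<alpha>)\<^sup>2 * (1 - (\<alpha> * \<beta>)\<^sup>2)"

text \<open>The last alternative is imposed for every pair of pressures separately. This is implied by
  requiring that one and the same case applies to all pairs.\<close>

definition constitutive_bounds :: "two_phase \<Rightarrow> real \<Rightarrow> real \<Rightarrow> bool" where
  "constitutive_bounds E \<alpha> \<beta> \<longleftrightarrow>
     0 < \<alpha> \<and> \<alpha> < 1 \<and> 0 < \<beta> \<and> \<alpha> * \<beta> < 1 \<and>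
     (\<forall>p\<in>vapor_range E \<alpha>. \<forall>q\<ge>pmin E.
        0 < vL E q / vV E p \<and> vL E q / vV E p \<le> \<alpha> \<and>
        0 < (vL E q * aV E p) / (vV E p * aL E q) \<and>
        (vL E q * aV E p) / (vV E p * aL E q) \<le> \<alpha> * \<beta>) \<and>
     (\<forall>p\<in>vapor_range E \<alpha>. tau E * (1 - \<alpha>)\<^sup>2 * aV E p ^ 3 < gam (vapor E) p) \<and>
     (\<forall>p\<in>vapor_range E \<alpha>. \<forall>q>0.
        (gam (vapor E) p \<le> 1 \<and> 1 \<le> gam (liquid E) q \<and>
         1 / gam (liquid E) q \<ge> 1 + eps E \<alpha> \<beta> p / \<alpha>) \<or>
        (gam (vapor E) p < 1 \<and> gam (liquid E) q < 1 \<and>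
         \<alpha> \<le> (1 - 1 / gam (vapor E) p) / (1 - 1 / gam (liquid E) q) \<and>
         eps E \<alpha> \<beta> p \<le> 0))"


section \<open>The liquid pressure at a phase boundary\<close>

definition h :: "two_phase \<Rightarrow> real \<Rightarrow> real \<Rightarrow> real" where
  "h E p q = tau E * (gL E q - gV E p - 1 / 2 * (q - p) * (vL E q + vV E p))"

definition interface_pressure :: "two_phase \<Rightarrow> real \<Rightarrow> real \<Rightarrow> bool" where
  "interface_pressure E p q \<longleftrightarrow>
     pmin E \<le> q \<and>
     q - p + (p * h E p q)\<^sup>2 * (vL E q - vV E p) = 0 \<and>
     - (aV E p / vV E p) \<le> p * h E p q \<and> p * h E p q \<le> aL E q / vL E q"

definition phi :: "two_phase \<Rightarrow> real \<Rightarrow> real" where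
  "phi E p = (THE q. interface_pressure E p q)"

definition zflux :: "two_phase \<Rightarrow> real \<Rightarrow> real" where
  "zflux E p = p * h E p (phi E p)"


section \<open>The cavitation function and the function \<open>f\<^sub>z\<close>\<close>

text \<open>A state of a given phase is the pair of its pressure and velocity; its density is
  \<open>1 / v p\<close>, which determines the pressure because \<open>v\<close> is strictly decreasing.\<close>

type_synonym state = "real \<times> real"

text \<open>In the second case \<open>q \<le> pL\<close>, so the oriented integral from \<open>pL\<close> to \<open>q\<close> is minus the
  integral over \<open>{q..pL}\<close>.\<close>

definition wave_fun :: "two_phase \<Rightarrow> real \<Rightarrow> real \<Rightarrow> real" where
  "wave_fun E pL q =
     (if q > pL then sqrt (- (q - pL) * (vL E q - vL E pL))
      else - integral {q..pL} (\<lambda>\<zeta>. vL E \<zeta> / aL E \<zeta>))"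

definition cav_fun :: "two_phase \<Rightarrow> state \<Rightarrow> state \<Rightarrow> real \<Rightarrow> real" where
  "cav_fun E Wm Wp p = wave_fun E (fst Wm) p + wave_fun E (fst Wp) p + snd Wp - snd Wm"

definition cavitation_criterion :: "two_phase \<Rightarrow> state \<Rightarrow> state \<Rightarrow> bool" where
  "cavitation_criterion E Wm Wp \<longleftrightarrow> \<not> (\<exists>p\<ge>pmin E. cav_fun E Wm Wp p = 0)"

definition f_side :: "two_phase \<Rightarrow> real \<Rightarrow> state \<Rightarrow> real" where
  "f_side E p W = wave_fun E (fst W) (phi E p)"

definition f_z :: "two_phase \<Rightarrow> real \<Rightarrow> state \<Rightarrow> state \<Rightarrow> real" where
  "f_z E p Wm Wp =
     f_side E p Wm + f_side E p Wp + 2 * zflux E p * (vL E (phi E p) - vV E p)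
     + (snd Wp - snd Wm)"


section \<open>The Riemann problem with phase transition\<close>

definition mass_flux :: "phase \<Rightarrow> state \<Rightarrow> real \<Rightarrow> real" where
  "mass_flux K S W = - (1 / spec_vol K (fst S)) * (snd S - W)"

text \<open>The kinetic energy in the entropy inequality and in the kinetic relation is that of the
  velocity relative to the discontinuity. Only this Galilean invariant form agrees with the
  energy inequality of the Euler system, and by \<open>u - W = - Z v\<close> and \<open>[p] = - Z\<^sup>2 [v]\<close> it is the
  one that turns the kinetic relation into \<open>p * h E p q\<close>.\<close>

definition total_gibbs :: "phase \<Rightarrow> state \<Rightarrow> real \<Rightarrow> real" where
  "total_gibbs K S W = gibbs K (fst S) + 1 / 2 * (snd S - W)\<^sup>2"

text \<open>Left state \<open>Sl\<close> in phase \<open>Kl\<close>, right state \<open>Sr\<close> in phase \<open>Kr\<close>, speed \<open>W\<close>.\<close>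

definition discontinuity :: "phase \<Rightarrow> state \<Rightarrow> phase \<Rightarrow> state \<Rightarrow> real \<Rightarrow> bool" where
  "discontinuity Kl Sl Kr Sr W \<longleftrightarrow>
     (let Z = mass_flux Kl Sl W in
        mass_flux Kr Sr W - Z = 0 \<and>
        - Z * (snd Sr - snd Sl) + (fst Sr - fst Sl) = 0 \<and>
        Z * (total_gibbs Kr Sr W - total_gibbs Kl Sl W) \<ge> 0)"

definition shock :: "phase \<Rightarrow> state \<Rightarrow> state \<Rightarrow> real \<Rightarrow> bool" where
  "shock K Sl Sr W \<longleftrightarrow> Sl \<noteq> Sr \<and> discontinuity K Sl K Sr W"

text \<open>With \<open>\<rho>(t,x) = R (x/t)\<close>, \<open>u(t,x) = U (x/t)\<close> and \<open>\<xi> = x/t\<close>, the Euler equations become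
  \<open>- \<xi> R' + (R U)' = 0\<close> and \<open>- \<xi> (R U)' + (R U\<^sup>2 + P)' = 0\<close>.\<close>

definition self_similar_Euler ::
  "(real \<Rightarrow> real) \<Rightarrow> (real \<Rightarrow> real) \<Rightarrow> (real \<Rightarrow> real) \<Rightarrow> real \<Rightarrow> bool" where
  "self_similar_Euler R U P \<xi> \<longleftrightarrow> (\<exists>dR dM dF.
     (R has_real_derivative dR) (at \<xi>) \<and>
     ((\<lambda>y. R y * U y) has_real_derivative dM) (at \<xi>) \<and>
     ((\<lambda>y. R y * (U y)\<^sup>2 + P y) has_real_derivative dF) (at \<xi>) \<and>
     - \<xi> * dR + dM = 0 \<and> - \<xi> * dM + dF = 0)"

text \<open>A centered rarefaction fan in the sector \<open>\<xi>1 \<le> x/t \<le> \<xi>2\<close>, of the family with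
  characteristic speed \<open>u + s a\<close>, \<open>s \<in> {-1, 1}\<close>. If \<open>\<xi>1 = \<xi>2\<close>, the two states coincide and the
  wave is absent (zero strength). All states of the fan have pressure at least \<open>pm\<close>.\<close>

definition rarefaction ::
  "phase \<Rightarrow> real \<Rightarrow> real \<Rightarrow> state \<Rightarrow> state \<Rightarrow> real \<Rightarrow> real \<Rightarrow> bool" where
  "rarefaction K pm s Sl Sr \<xi>1 \<xi>2 \<longleftrightarrow> \<xi>1 \<le> \<xi>2 \<and> (\<exists>P U.
     (P \<xi>1, U \<xi>1) = Sl \<and> (P \<xi>2, U \<xi>2) = Sr \<and>
     continuous_on {\<xi>1..\<xi>2} P \<and> continuous_on {\<xi>1..\<xi>2} U \<and>
     (\<forall>\<xi>\<in>{\<xi>1..\<xi>2}. pm \<le> P \<xi> \<and> \<xi> = U \<xi> + s * sound K (P \<xi>)) \<and>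
     (\<forall>\<xi>\<in>{\<xi>1<..<\<xi>2}. self_similar_Euler (\<lambda>y. 1 / spec_vol K (P y)) U P \<xi>))"

text \<open>The family of a wave is not prescribed: it follows from the ordering of the waves.\<close>

definition liquid_wave :: "two_phase \<Rightarrow> state \<Rightarrow> state \<Rightarrow> real \<Rightarrow> real \<Rightarrow> bool" where
  "liquid_wave E Sl Sr \<xi>1 \<xi>2 \<longleftrightarrow>
     (\<xi>1 = \<xi>2 \<and> shock (liquid E) Sl Sr \<xi>1) \<or>
     (\<exists>s\<in>{-1, 1}. rarefaction (liquid E) (pmin E) s Sl Sr \<xi>1 \<xi>2)"

definition kinetic_flux :: "two_phase \<Rightarrow> state \<Rightarrow> state \<Rightarrow> real \<Rightarrow> real" where
  "kinetic_flux E SV SL W =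
     tau E * fst SV * (total_gibbs (liquid E) SL W - total_gibbs (vapor E) SV W)"

definition admissible_flux :: "two_phase \<Rightarrow> state \<Rightarrow> state \<Rightarrow> real \<Rightarrow> bool" where
  "admissible_flux E SV SL W \<longleftrightarrow>
     - (aV E (fst SV) / vV E (fst SV)) \<le> kinetic_flux E SV SL W \<and>
     kinetic_flux E SV SL W \<le> aL E (fst SL) / vL E (fst SL)"

definition boundary_LV :: "two_phase \<Rightarrow> state \<Rightarrow> state \<Rightarrow> real \<Rightarrow> bool" where
  "boundary_LV E SL SV W \<longleftrightarrow>
     discontinuity (liquid E) SL (vapor E) SV W \<and>
     mass_flux (vapor E) SV W = - kinetic_flux E SV SL W \<and> admissible_flux E SV SL W"

definition boundary_VL :: "two_phase \<Rightarrow> state \<Rightarrow> state \<Rightarrow> real \<Rightarrow> bool" where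
  "boundary_VL E SV SL W \<longleftrightarrow>
     discontinuity (vapor E) SV (liquid E) SL W \<and>
     mass_flux (vapor E) SV W = kinetic_flux E SV SL W \<and> admissible_flux E SV SL W"

text \<open>The self-similar solution equals \<open>Wm\<close> for \<open>x/t < \<xi>1\<close>, the liquid state \<open>S1\<close> for
  \<open>\<xi>2 < x/t < W1\<close>, the vapor state \<open>(pV, uV)\<close> for \<open>W1 < x/t < W2\<close>, the liquid state \<open>S2\<close> for
  \<open>W2 < x/t < \<xi>3\<close> and \<open>Wp\<close> for \<open>\<xi>4 < x/t\<close>; classical waves occupy \<open>[\<xi>1, \<xi>2]\<close> and
  \<open>[\<xi>3, \<xi>4]\<close>.\<close>

definition phase_transition_solution ::
  "two_phase \<Rightarrow> state \<Rightarrow> state \<Rightarrow> real \<Rightarrow> real \<Rightarrow> bool" where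
  "phase_transition_solution E Wm Wp pV uV \<longleftrightarrow>
     pV > 0 \<and>
     (\<exists>S1 S2 \<xi>1 \<xi>2 W1 W2 \<xi>3 \<xi>4.
        pmin E \<le> fst S1 \<and> pmin E \<le> fst S2 \<and>
        \<xi>2 < W1 \<and> W1 < W2 \<and> W2 < \<xi>3 \<and>
        liquid_wave E Wm S1 \<xi>1 \<xi>2 \<and>
        boundary_LV E S1 (pV, uV) W1 \<and>
        boundary_VL E (pV, uV) S2 W2 \<and>
        liquid_wave E S2 Wp \<xi>3 \<xi>4)"

end

theory Submission
  imports Defs
begin

text \<open>Positivity of the fundamental derivative makes the liquid curve \<open>v\<^sub>L\<close> strictly convex, so for
  fixed vapor pressure the flux \<open>p h(p, q)\<close> decreases in \<open>q \<ge> p\<close>. The cavitation criterion says that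
  \<open>F\<close> is positive everywhere, and \<open>f\<^sub>z(p) = F(\<phi>(p)) - 2 z(p) (v\<^sub>V(p) - v\<^sub>L(\<phi>(p)))\<close>, so \<open>z > 0\<close> at every
  root of \<open>f\<^sub>z\<close>, which forces \<open>p < p\<^sub>0\<close>. On \<open>(0, p\<^sub>0)\<close> the function \<open>\<phi>\<close> is differentiable by the implicit
  function theorem and \<open>f\<^sub>z' > 0\<close>. With \<open>x = z v\<^sub>L / a\<^sub>L\<close>, \<open>y = z v\<^sub>V / a\<^sub>V\<close> and \<open>C\<close> the sum of the slopes of
  the two wave curves, \<open>z f\<^sub>z' = z C \<phi>' + 1 + y\<^sup>2 - (1 + x\<^sup>2) \<phi>'\<close>. Convexity gives
  \<open>2 x \<le> z C \<le> 2 \<alpha> \<beta> y\<close>, and the constitutive bounds show that \<open>\<phi>' < 0\<close> is possible only for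
  \<open>y < 1\<close>, where \<open>\<phi>' \<ge> -1\<close>.

  Across the phase boundaries the jump conditions are equivalent to \<open>q = \<phi>(p)\<close> with flux \<open>z\<close>, and
  the order of the waves excludes all but one family on each side; the velocities then match
  exactly when \<open>f\<^sub>z(p) = 0\<close>.\<close>

section \<open>A single phase\<close>

text \<open>The numbers \<open>x\<close> and \<open>y\<close> are the Mach numbers of the flow
  relative to the phase boundary, on the liquid and on the vapor side, since the relative speed
  there is \<open>z v\<close>. For \<open>z > 0\<close> the admissible range of the flux bounds only
  \<open>x\<close> by 1. The vapor may be supersonic, \<open>1 - y^2\<close> may be negative, and
  then only a lower bound on the kinetic coefficient, linear in \<open>y\<close>, keeps \<phi>' from
  becoming negative.

  A second obstacle is that \<phi> is given by unique existence alone, with no regularity in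
  \<open>p\<close>, while implicit differentiation needs continuity first. Uniqueness is therefore
  used as a recognition principle: a zero of the interface equation found between two pressures
  where that equation changes sign, and satisfying the side conditions, must be \<phi>. Such a
  bracket is described by strict inequalities, which persist under small changes of
  \<open>p\<close>, and this yields continuity. Below saturation \<open>0 < z\<close> and
  \<open>x < 1\<close> hold strictly, so the derivative of the interface equation in
  \<open>q\<close> is positive there.\<close>

locale convex_phase =
  fixes K :: phase and m :: real
  assumes regular: "regular_phase K {m..}"
begin

abbreviation "v \<equiv> spec_vol K"
abbreviation "a \<equiv> sound K"
abbreviation "g \<equiv> gibbs K"

text \<open>The reciprocal of the acoustic impedance \<open>a / v\<close>. It is the square root of
  \<open>- v'\<close> and the integrand of the rarefaction curve, and a mass flux \<open>Z\<close>
  is subsonic relative to the state exactly when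
  \<open>\<bar>Z\<bar> * admittance p < 1\<close>.\<close>

definition admittance :: "real \<Rightarrow> real" where
  "admittance p = v p / a p"

lemma v_pos: "m \<le> p \<Longrightarrow> 0 < v p"
  and a_pos: "m \<le> p \<Longrightarrow> 0 < a p"
  using regular by (auto simp: regular_phase_def)

lemma admittance_pos: "m \<le> p \<Longrightarrow> 0 < admittance p"
  by (simp add: admittance_def v_pos a_pos)

lemma v_deriv_within:
  "m \<le> p \<Longrightarrow> (v has_real_derivative - (admittance p)\<^sup>2) (at p within {m..})"
  using regular by (auto simp: regular_phase_def admittance_def power_divide)

lemma g_deriv_within: "m \<le> p \<Longrightarrow> (g has_real_derivative v p) (at p within {m..})"
  using regular by (auto simp: regular_phase_def)

lemma at_within_interior_ray: "m < p \<Longrightarrow> at p within {m..} = at p" for p :: real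
  by (rule at_within_interior) (simp add: interior_Ici[of "m - 1"])

lemma v_deriv: "m < p \<Longrightarrow> (v has_real_derivative - (admittance p)\<^sup>2) (at p)"
  using v_deriv_within[of p] by (simp add: at_within_interior_ray)

lemma g_deriv: "m < p \<Longrightarrow> (g has_real_derivative v p) (at p)"
  using g_deriv_within[of p] by (simp add: at_within_interior_ray)

lemma v_continuous: "continuous_on {m..} v"
  using v_deriv_within by (auto intro!: DERIV_continuous_on)

lemma g_continuous: "continuous_on {m..} g"
  using g_deriv_within by (auto intro!: DERIV_continuous_on)

text \<open>\<open>C2_on\<close> only provides some \<open>f'\<close> and \<open>f''\<close>.
  Derivatives within the half-line are unique, also at its endpoint, so \<open>f'\<close> must be
  \<open>- admittance^2\<close>.\<close>

lemma second_deriv: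
  obtains f'' where
    "\<And>p. m \<le> p \<Longrightarrow> ((\<lambda>p. - (admittance p)\<^sup>2) has_real_derivative f'' p) (at p within {m..})"
proof -
  from regular obtain f' f''
    where f': "\<And>p. m \<le> p \<Longrightarrow> (v has_real_derivative f' p) (at p within {m..})"
      and f'': "\<And>p. m \<le> p \<Longrightarrow> (f' has_real_derivative f'' p) (at p within {m..})"
    unfolding regular_phase_def C2_on_def atLeast_iff Ball_def by metis
  have eq: "f' p = - (admittance p)\<^sup>2" if "m \<le> p" for p
  proof -
    have "at p within {m..} \<noteq> bot"
      using that by (metis trivial_limit_at_right_real at_within_Ici_at_right at_le atLeast_iff atLeast_subset_iff at_within_eq_bot_iff bot.extremum_uniqueI)
    then show ?thesis
      using f'[OF that] v_deriv_within[OF that] vector_derivative_unique_within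
      unfolding has_real_derivative_iff_has_vector_derivative by blast
  qed
  show thesis
    by (rule that, rule has_field_derivative_transform_within[OF f'' zero_less_one])
      (auto simp: eq)
qed

text \<open>Regularity of the sound speed has to be recovered from that of \<open>v\<close>: the
  admittance is the positive root of the continuous function \<open>- v'\<close>.\<close>

lemma admittance_continuous: "continuous_on {m..} admittance"
proof -
  obtain f'' where "\<And>p. m \<le> p \<Longrightarrow>
      ((\<lambda>p. - (admittance p)\<^sup>2) has_real_derivative f'' p) (at p within {m..})"
    by (rule second_deriv) blast
  then have "continuous_on {m..} (\<lambda>p. - (admittance p)\<^sup>2)"
    by (auto intro!: DERIV_continuous_on)
  then have "continuous_on {m..} (\<lambda>p. sqrt (- (- (admittance p)\<^sup>2)))"
    by (rule continuous_on_real_sqrt[OF continuous_on_minus])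
  then show ?thesis
    by (rule continuous_on_eq) (use admittance_pos in \<open>auto simp: less_imp_le\<close>)
qed

lemma a_eq: "m \<le> p \<Longrightarrow> a p = v p / admittance p"
  using v_pos[of p] a_pos[of p] by (simp add: admittance_def)

lemma a_continuous: "continuous_on {m..} a"
proof -
  have "continuous_on {m..} (\<lambda>p. v p / admittance p)"
    using admittance_pos by (intro continuous_intros v_continuous admittance_continuous)
      (auto simp: less_le)
  then show ?thesis
    by (rule continuous_on_eq) (auto simp: a_eq)
qed

text \<open>\<open>fund_deriv\<close> is built on \<open>vector_derivative\<close>, which carries
  information only where a derivative exists. Writing \<open>a\<close> as
  \<open>v / sqrt (- v')\<close> gives differentiability; multiplying \<open>fund_deriv > 0\<close>
  by the admittance then gives the sign.\<close>

lemma a_deriv: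
  assumes "m < p"
  obtains d where "(a has_real_derivative d) (at p)" "0 < admittance p + d"
proof -
  obtain f'' where f'': "\<And>p. m \<le> p \<Longrightarrow>
      ((\<lambda>p. - (admittance p)\<^sup>2) has_real_derivative f'' p) (at p within {m..})"
    by (rule second_deriv) blast
  have sq: "((\<lambda>p. - (admittance p)\<^sup>2) has_real_derivative f'' p) (at p)"
    using f''[of p] assms by (simp add: at_within_interior_ray)
  have pos: "0 < - (- (admittance p)\<^sup>2)"
    using admittance_pos[of p] assms by simp
  have "((\<lambda>p. v p / sqrt (- (- (admittance p)\<^sup>2))) has_real_derivative
      ((- (admittance p)\<^sup>2) * sqrt (- (- (admittance p)\<^sup>2))
        - v p * (inverse (sqrt (- (- (admittance p)\<^sup>2))) / 2 * - f'' p))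
        / (sqrt (- (- (admittance p)\<^sup>2)) * sqrt (- (- (admittance p)\<^sup>2)))) (at p)"
    using pos
    by (intro DERIV_divide v_deriv assms DERIV_chain2[where f = sqrt] DERIV_minus sq
        DERIV_real_sqrt) auto
  then obtain d where d: "((\<lambda>p. v p / sqrt (- (- (admittance p)\<^sup>2))) has_real_derivative d) (at p)"
    by blast
  have d: "(a has_real_derivative d) (at p)"
    by (rule has_field_derivative_transform_within_open[OF d, of "{m<..}"])
      (use assms admittance_pos in \<open>auto simp: a_eq less_imp_le\<close>)
  have "vector_derivative a (at p within {m..}) = d"
    using d assms
    by (simp add: at_within_interior_ray has_real_derivative_iff_has_vector_derivative
        vector_derivative_at)
  moreover have "0 < fund_deriv K {m..} p"
    using regular assms by (auto simp: regular_phase_def)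
  ultimately have "0 < admittance p * (1 + a p / v p * d)"
    using admittance_pos[of p] assms by (simp add: fund_deriv_def)
  also have "\<dots> = admittance p + d"
    using v_pos[of p] a_pos[of p] assms by (simp add: admittance_def field_simps)
  finally show thesis
    using d that by blast
qed

text \<open>The derivative of \<open>v / a\<close> is
  \<open>- (v / a^2) * (admittance + a')\<close>, so a positive fundamental derivative is the same
  as strict convexity of \<open>v\<close>.\<close>

lemma admittance_deriv:
  assumes "m < p"
  obtains d where "(admittance has_real_derivative d) (at p)" "d < 0"
proof -
  from a_deriv[OF assms] obtain d
    where d: "(a has_real_derivative d) (at p)" and pos: "0 < admittance p + d" .
  have vp: "0 < v p" and ap: "0 < a p"
    using assms v_pos a_pos by auto
  have "((\<lambda>p. v p / a p) has_real_derivative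
      (- (admittance p)\<^sup>2 * a p - v p * d) / (a p * a p)) (at p)"
    using ap by (intro DERIV_divide v_deriv assms d) auto
  moreover have "(- (admittance p)\<^sup>2 * a p - v p * d) / (a p * a p) =
      - (v p / (a p)\<^sup>2 * (admittance p + d))"
    using ap by (simp add: admittance_def field_simps power2_eq_square)
  moreover have "- (v p / (a p)\<^sup>2 * (admittance p + d)) < 0"
    using vp ap pos by (simp add: mult_pos_pos)
  ultimately show thesis
    using that unfolding admittance_def[abs_def] by metis
qed

lemma admittance_isCont: "m < p \<Longrightarrow> isCont admittance p"
  by (erule admittance_deriv) (rule DERIV_isCont)

lemma admittance_strict_antimono:
  assumes "m \<le> p" "p < q"
  shows "admittance q < admittance p"
proof (rule DERIV_neg_imp_decreasing_open[OF assms(2)])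
  show "\<exists>y. (admittance has_real_derivative y) (at x) \<and> y < 0" if "p < x" "x < q" for x
    using that assms admittance_deriv[of x] by (metis less_le_trans not_le order_le_less_trans)
  show "continuous_on {p..q} admittance"
    using admittance_continuous by (rule continuous_on_subset) (use assms in auto)
qed

lemma admittance_antimono: "m \<le> p \<Longrightarrow> p \<le> q \<Longrightarrow> admittance q \<le> admittance p"
  using admittance_strict_antimono[of p q] by (cases "p = q") auto

lemma v_MVT:
  assumes "m \<le> p" "p < q"
  obtains r where "p < r" "r < q" "v p - v q = (q - p) * (admittance r)\<^sup>2"
proof -
  have "\<exists>l r. p < r \<and> r < q \<and> (v has_real_derivative l) (at r) \<and> v q - v p = (q - p) * l"
  proof (rule MVT[OF assms(2)])
    show "continuous_on {p..q} v"
      using v_continuous by (rule continuous_on_subset) (use assms in auto)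
    show "v differentiable at x" if "p < x" "x < q" for x
      using v_deriv[of x] that assms real_differentiable_def by auto
  qed
  then obtain r l where r: "p < r" "r < q" "(v has_real_derivative l) (at r)"
      "v q - v p = (q - p) * l" by blast
  then have "l = - (admittance r)\<^sup>2"
    using v_deriv[of r] assms DERIV_unique by fastforce
  with r that[of r] show thesis by (simp add: algebra_simps)
qed

lemma v_strict_antimono:
  assumes "m \<le> p" "p < q"
  shows "v q < v p"
proof -
  from v_MVT[OF assms] obtain r where "p < r" "v p - v q = (q - p) * (admittance r)\<^sup>2" by metis
  with assms admittance_pos[of r] have "0 < v p - v q" by simp
  then show ?thesis by simp
qed

lemma chord_gt_right:
  assumes "m \<le> p" "p < q"
  shows "(q - p) * (admittance q)\<^sup>2 < v p - v q"
proof -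
  from v_MVT[OF assms] obtain r
    where r: "p < r" "r < q" "v p - v q = (q - p) * (admittance r)\<^sup>2" .
  have "(admittance q)\<^sup>2 < (admittance r)\<^sup>2"
    using r assms admittance_strict_antimono[of r q] admittance_pos[of q]
    by (intro power_strict_mono) auto
  with r(3) assms show ?thesis by simp
qed

lemma chord_slope_antimono:
  assumes "m \<le> p" "p \<le> r" "r < q"
  shows "(v r - v q) / (q - r) \<le> (v p - v q) / (q - p)"
proof (cases "p = r")
  case False
  with assms have pr: "p < r" by simp
  from v_MVT[OF assms(1) pr] obtain s
    where s: "p < s" "s < r" "v p - v r = (r - p) * (admittance s)\<^sup>2" .
  from v_MVT[of r q] assms obtain t
    where t: "r < t" "t < q" "v r - v q = (q - r) * (admittance t)\<^sup>2" by auto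
  have "(admittance t)\<^sup>2 \<le> (admittance s)\<^sup>2"
    using s t assms admittance_antimono[of s t] admittance_pos[of t]
    by (intro power_mono) auto
  then have "(r - p) * (admittance t)\<^sup>2 \<le> (r - p) * (admittance s)\<^sup>2"
    using pr by (intro mult_left_mono) auto
  moreover have "v p - v q = (r - p) * (admittance s)\<^sup>2 + (q - r) * (admittance t)\<^sup>2"
    using s(3) t(3) by simp
  ultimately have "(q - p) * (admittance t)\<^sup>2 \<le> v p - v q"
    by (simp add: algebra_simps)
  moreover have "(v r - v q) / (q - r) = (admittance t)\<^sup>2"
    using t assms by simp
  ultimately show ?thesis
    using assms by (simp add: pos_le_divide_eq mult.commute)
qed auto

text \<open>\<open>g q - g p\<close> is the integral of the strictly convex \<open>v\<close>, which
  lies below the trapezoid of its chord. This decides the entropy inequality: only compressive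
  shocks are admissible.\<close>

lemma gibbs_lt_trapezoid:
  assumes "m \<le> p" "p < q"
  shows "g q - g p < 1 / 2 * (q - p) * (v q + v p)"
proof -
  let ?T = "\<lambda>q. g q - g p - 1 / 2 * (q - p) * (v q + v p)"
  have "?T q < ?T p"
  proof (rule DERIV_neg_imp_decreasing_open[OF assms(2)])
    fix x assume x: "p < x" "x < q"
    have "(?T has_real_derivative
        v x - (1 / 2 * (x - p) * - (admittance x)\<^sup>2 + 1 / 2 * (v x + v p))) (at x)"
      using x assms by (auto intro!: derivative_eq_intros v_deriv g_deriv simp: field_simps)
    moreover have "v x - (1 / 2 * (x - p) * - (admittance x)\<^sup>2 + 1 / 2 * (v x + v p)) < 0"
      using chord_gt_right[of p x] x assms by (simp add: field_simps)
    ultimately show "\<exists>y. (?T has_real_derivative y) (at x) \<and> y < 0" by blast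
  next
    have "continuous_on {p..q} g" "continuous_on {p..q} v"
      using continuous_on_subset[OF g_continuous] continuous_on_subset[OF v_continuous] assms
      by auto
    then show "continuous_on {p..q} ?T"
      by (intro continuous_intros)
  qed
  then show ?thesis by simp
qed

section \<open>The Riemann invariant and the characteristic speed\<close>

definition riemann :: "real \<Rightarrow> real" where
  "riemann p = integral {m..p} admittance"

lemma admittance_integrable: "m \<le> p \<Longrightarrow> admittance integrable_on {p..q}"
  by (rule integrable_continuous_real, rule continuous_on_subset[OF admittance_continuous]) auto

lemma riemann_diff:
  assumes "m \<le> p" "p \<le> q"
  shows "integral {p..q} admittance = riemann q - riemann p"
  using Henstock_Kurzweil_Integration.integral_combine[OF assms admittance_integrable[of m]]
  by (simp add: riemann_def)

lemma riemann_deriv_within: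
  assumes "m \<le> p"
  shows "(riemann has_real_derivative admittance p) (at p within {m..})"
proof -
  have "(riemann has_real_derivative admittance p) (at p within {m..p + 1})"
    unfolding riemann_def
    by (rule integral_has_real_derivative, rule continuous_on_subset[OF admittance_continuous])
      (use assms in auto)
  moreover have "at p within {m..p + 1} = at p within {m..}"
    by (rule at_within_nhd[of _ "{..<p + 1}"]) (use assms in auto)
  ultimately show ?thesis by simp
qed

lemma riemann_deriv: "m < p \<Longrightarrow> (riemann has_real_derivative admittance p) (at p)"
  using riemann_deriv_within[of p] by (simp add: at_within_interior_ray)

lemma riemann_continuous: "continuous_on {m..} riemann"
  using riemann_deriv_within by (auto intro!: DERIV_continuous_on)

text \<open>Along a rarefaction curve \<open>u = const + s * riemann p\<close>, so
  \<open>u + s * a p\<close> is, up to a constant, \<open>s * (riemann p + a p)\<close>. Its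
  monotonicity is genuine nonlinearity.\<close>

lemma riemann_plus_a_deriv:
  assumes "m < p"
  obtains d where "((\<lambda>p. riemann p + a p) has_real_derivative d) (at p)" "0 < d"
  using a_deriv[OF assms] DERIV_add[OF riemann_deriv[OF assms]] by metis

lemma riemann_plus_a_continuous: "continuous_on {m..} (\<lambda>p. riemann p + a p)"
  by (intro continuous_intros riemann_continuous a_continuous)

lemma riemann_plus_a_strict_mono:
  assumes "m \<le> p" "p < q"
  shows "riemann p + a p < riemann q + a q"
proof (rule DERIV_pos_imp_increasing_open[OF assms(2), where f = "\<lambda>p. riemann p + a p"])
  show "\<exists>y. ((\<lambda>p. riemann p + a p) has_real_derivative y) (at x) \<and> 0 < y" if "p < x" "x < q" for x
    using that assms riemann_plus_a_deriv[of x] by (metis order_le_less_trans)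
  show "continuous_on {p..q} (\<lambda>p. riemann p + a p)"
    using riemann_plus_a_continuous by (rule continuous_on_subset) (use assms in auto)
qed

end

section \<open>Shocks and rarefactions\<close>

lemma sqrt_linear_at_top:
  fixes c d :: real
  assumes "0 < d"
  shows "filterlim (\<lambda>x. sqrt ((x - c) * d)) at_top at_top"
proof -
  have "filterlim (\<lambda>x. (- c + x) * d) at_top at_top"
    by (intro filterlim_at_top_mult_tendsto_pos[OF tendsto_const assms]
        filterlim_tendsto_add_at_top[OF tendsto_const] filterlim_ident)
  then show ?thesis
    using filterlim_compose[OF sqrt_at_top] by simp
qed

text \<open>The mirror image \<open>x -> - x\<close>, which also negates speeds and exchanges left
  and right. It transfers the left-hand results on shocks and phase boundaries to the right-hand
  ones.\<close>

definition reflect :: "state \<Rightarrow> state" where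
  "reflect S = (fst S, - snd S)"

lemma reflect_simps [simp]:
  "fst (reflect S) = fst S" "snd (reflect S) = - snd S" "reflect (reflect S) = S"
  "reflect (p, u) = (p, - u)" "reflect S = reflect T \<longleftrightarrow> S = T"
  by (auto simp: reflect_def prod_eq_iff)

lemma mass_flux_reflect: "mass_flux K (reflect S) (- W) = - mass_flux K S W"
  by (simp add: mass_flux_def divide_inverse algebra_simps)

lemma total_gibbs_reflect: "total_gibbs K (reflect S) (- W) = total_gibbs K S W"
  by (simp add: total_gibbs_def power2_eq_square algebra_simps)

lemma discontinuity_reflect:
  "discontinuity Kr (reflect Sr) Kl (reflect Sl) (- W) \<longleftrightarrow> discontinuity Kl Sl Kr Sr W"
  by (auto simp: discontinuity_def Let_def mass_flux_reflect total_gibbs_reflect algebra_simps)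

lemma shock_reflect: "shock K (reflect Sr) (reflect Sl) (- W) \<longleftrightarrow> shock K Sl Sr W"
  by (auto simp: shock_def discontinuity_reflect)

lemma boundary_reflect:
  "boundary_VL E (reflect SV) (reflect SL) (- W) \<longleftrightarrow> boundary_LV E SL SV W"
  by (auto simp: boundary_VL_def boundary_LV_def discontinuity_reflect mass_flux_reflect
      kinetic_flux_def total_gibbs_reflect admissible_flux_def)

context convex_phase
begin

section \<open>Wave curves\<close>

definition wave :: "real \<Rightarrow> real \<Rightarrow> real" where
  "wave p q = (if p < q then sqrt ((q - p) * (v p - v q)) else riemann q - riemann p)"

text \<open>\<open>s\<close> is the root of the chord slope of \<open>v\<close>, that is, the
  admittance at the mean value point. Enclosing it between the two end values is all that the slope
  estimates of the shock branch require.\<close>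

lemma wave_shock_quotient:
  assumes "m \<le> p" "p < q"
  obtains s where "admittance q \<le> s" "s \<le> admittance p" "wave p q = (q - p) * s"
    "v p - v q = (q - p) * s\<^sup>2"
proof -
  from v_MVT[OF assms] obtain r
    where r: "p < r" "r < q" "v p - v q = (q - p) * (admittance r)\<^sup>2" .
  have "wave p q = sqrt (((q - p) * admittance r)\<^sup>2)"
    unfolding wave_def r(3) using assms by (simp add: power2_eq_square mult_ac)
  also have "\<dots> = (q - p) * admittance r"
    using assms r admittance_pos[of r] by simp
  finally show thesis
    using that[of "admittance r"] r assms admittance_antimono[of p r] admittance_antimono[of r q]
    by auto
qed

text \<open>The branches join with equal slopes: on the shock side the difference quotient is
  squeezed between \<open>admittance y\<close> and \<open>admittance p\<close>.\<close>

lemma wave_deriv_at_base: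
  assumes "m < p"
  shows "(wave p has_real_derivative admittance p) (at p)"
  unfolding has_field_derivative_iff
proof (rule filterlim_split_at)
  have cont: "isCont admittance p"
    by (rule admittance_isCont[OF assms])
  have "((\<lambda>y. (riemann y - riemann p) / (y - p)) \<longlongrightarrow> admittance p) (at_left p)"
    using riemann_deriv[OF assms] unfolding has_field_derivative_iff
    by (rule tendsto_within_subset) auto
  moreover have "\<forall>\<^sub>F y in at_left p. (wave p y - wave p p) / (y - p) = (riemann y - riemann p) / (y - p)"
    by (auto simp: eventually_at_filter wave_def)
  ultimately show "((\<lambda>y. (wave p y - wave p p) / (y - p)) \<longlongrightarrow> admittance p) (at_left p)"
    using tendsto_cong by fast
  show "((\<lambda>y. (wave p y - wave p p) / (y - p)) \<longlongrightarrow> admittance p) (at_right p)"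
  proof (rule real_tendsto_sandwich)
    show "(admittance \<longlongrightarrow> admittance p) (at_right p)"
      using cont unfolding isCont_def by (rule tendsto_within_subset) auto
    have "admittance y \<le> (wave p y - wave p p) / (y - p) \<and>
        (wave p y - wave p p) / (y - p) \<le> admittance p" if y: "p < y" for y
    proof -
      obtain s where "admittance y \<le> s" "s \<le> admittance p" "wave p y = (y - p) * s"
        using wave_shock_quotient[of p y] assms y by (metis less_imp_le)
      with y show ?thesis by (simp add: wave_def[of p p])
    qed
    then show "\<forall>\<^sub>F y in at_right p. admittance y \<le> (wave p y - wave p p) / (y - p)"
      "\<forall>\<^sub>F y in at_right p. (wave p y - wave p p) / (y - p) \<le> admittance p"
      by (auto simp: eventually_at_filter)
  qed auto
qed

text \<open>On the shock branch the slope is \<open>(s^2 + c^2) / (2 * s)\<close> with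
  \<open>c = admittance q\<close>. It is at least \<open>c\<close> by the inequality of arithmetic
  and geometric means, and at most \<open>s\<close> because \<open>c \<le> s\<close>.\<close>

lemma wave_deriv:
  assumes "m \<le> p" "m < q" and M: "\<And>r. m \<le> r \<Longrightarrow> admittance r \<le> M"
  obtains c where "(wave p has_real_derivative c) (at q)" "admittance q \<le> c" "c \<le> M"
proof -
  consider "q < p" | "q = p" | "p < q" by linarith
  then show thesis
  proof cases
    case 1
    have "((\<lambda>q. riemann q - riemann p) has_real_derivative admittance q) (at q)"
      using riemann_deriv[OF assms(2)] by (auto intro!: derivative_eq_intros)
    then have "(wave p has_real_derivative admittance q) (at q)"
      by (rule has_field_derivative_transform_within_open[of _ _ _ "{..<p}"])
        (use 1 in \<open>auto simp: wave_def\<close>)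
    with that M[of q] assms show thesis by auto
  next
    case 2
    with that[of "admittance p"] M[of p] assms wave_deriv_at_base show thesis by auto
  next
    case 3
    obtain s where s: "admittance q \<le> s" "s \<le> admittance p" "wave p q = (q - p) * s"
        "v p - v q = (q - p) * s\<^sup>2"
      using wave_shock_quotient[OF assms(1) 3] .
    have spos: "0 < s"
      using s(1) admittance_pos[of q] assms by simp
    have "0 < (q - p) * (v p - v q)"
      using 3 s spos by simp
    then have "((\<lambda>q. sqrt ((q - p) * (v p - v q))) has_real_derivative
        inverse (sqrt ((q - p) * (v p - v q))) / 2 *
          ((v p - v q) + (q - p) * (admittance q)\<^sup>2)) (at q)"
      using assms by (auto intro!: derivative_eq_intros v_deriv)
    then have "(wave p has_real_derivative inverse (wave p q) / 2 *
          ((v p - v q) + (q - p) * (admittance q)\<^sup>2)) (at q)"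
      using 3 by (intro has_field_derivative_transform_within_open[of _ _ _ "{p<..}" "wave p"])
        (auto simp: wave_def)
    moreover have "inverse (wave p q) / 2 * ((v p - v q) + (q - p) * (admittance q)\<^sup>2) =
        (s\<^sup>2 + (admittance q)\<^sup>2) / (2 * s)"
      unfolding s using 3 spos by (simp add: field_simps)
    moreover have "admittance q \<le> (s\<^sup>2 + (admittance q)\<^sup>2) / (2 * s)"
      using spos sum_squares_bound[of s "admittance q"]
      by (simp add: field_simps power2_eq_square)
    moreover have "(s\<^sup>2 + (admittance q)\<^sup>2) / (2 * s) \<le> s"
    proof -
      have "(admittance q)\<^sup>2 \<le> s\<^sup>2"
        using s(1) admittance_pos[of q] assms by (intro power_mono) auto
      then show ?thesis using spos by (simp add: field_simps power2_eq_square)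
    qed
    moreover have "s \<le> M" using s(2) M[OF assms(1)] by simp
    ultimately show thesis using that by (metis order_trans)
  qed
qed

lemma wave_continuous:
  assumes "m \<le> p"
  shows "continuous_on {m..} (wave p)"
proof -
  have "continuous_on ({m..p} \<union> {p..}) (\<lambda>q. if q \<le> p then riemann q - riemann p
      else sqrt ((q - p) * (v p - v q)))"
    by (intro continuous_on_If continuous_intros continuous_on_subset[OF riemann_continuous]
        continuous_on_subset[OF v_continuous]) (use assms in auto)
  moreover have "{m..p} \<union> {p..} = {m..}"
    using assms by auto
  moreover have "(\<lambda>q. if q \<le> p then riemann q - riemann p else sqrt ((q - p) * (v p - v q))) = wave p"
    by (auto simp: wave_def fun_eq_iff)
  ultimately show ?thesis by (simp only:)
qed

text \<open>Beyond \<open>p + 1\<close> the drop in volume is at least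
  \<open>v p - v (p + 1) > 0\<close>, so the shock branch grows at least like a square root.\<close>

lemma wave_at_top:
  assumes "m \<le> p"
  shows "filterlim (wave p) at_top at_top"
proof (rule filterlim_at_top_mono)
  let ?d = "v p - v (p + 1)"
  show "filterlim (\<lambda>q. sqrt ((q - p) * ?d)) at_top at_top"
    using v_strict_antimono[of p "p + 1"] assms by (intro sqrt_linear_at_top) auto
  have "sqrt ((q - p) * ?d) \<le> wave p q" if "p + 1 < q" for q
    using that v_strict_antimono[of "p + 1" q] assms
    by (auto simp: wave_def intro!: mult_left_mono)
  then show "\<forall>\<^sub>F q in at_top. sqrt ((q - p) * ?d) \<le> wave p q"
    by (rule eventually_mono[OF eventually_gt_at_top])
qed

section \<open>Admissible shocks\<close>

definition shock_flux :: "real \<Rightarrow> real \<Rightarrow> real" where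
  "shock_flux p q = sqrt ((q - p) / (v p - v q))"

lemma shock_flux_facts:
  assumes "m \<le> p" "p < q"
  shows "0 < shock_flux p q" "(shock_flux p q)\<^sup>2 * (v p - v q) = q - p"
    "shock_flux p q * (v p - v q) = wave p q" "shock_flux p q * wave p q = q - p"
proof -
  have d: "0 < v p - v q" using v_strict_antimono[OF assms] by simp
  show pos: "0 < shock_flux p q"
    using assms d by (simp add: shock_flux_def)
  show sq: "(shock_flux p q)\<^sup>2 * (v p - v q) = q - p"
    using assms d by (simp add: shock_flux_def)
  have "(q - p) * (v p - v q) = (shock_flux p q * (v p - v q))\<^sup>2"
    by (subst sq[symmetric]) (simp only: power2_eq_square mult_ac)
  then have "wave p q = sqrt ((shock_flux p q * (v p - v q))\<^sup>2)"
    using assms by (simp only: wave_def if_True)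
  then show "shock_flux p q * (v p - v q) = wave p q"
    using d pos by simp
  then show "shock_flux p q * wave p q = q - p"
    by (simp only: sq[symmetric] power2_eq_square mult.assoc)
qed

text \<open>The speed is chosen so that both relative velocities are \<open>shock_flux p q\<close>
  times the specific volume of their side. Conservation of mass is then immediate, and entropy is
  the trapezoid inequality.\<close>

lemma left_shock:
  assumes "m \<le> p" "p < q"
  shows "shock K (p, u) (q, u - wave p q) (u - wave p q - shock_flux p q * v q)"
proof -
  let ?M = "shock_flux p q" and ?W = "u - wave p q - shock_flux p q * v q"
  note M = shock_flux_facts[OF assms]
  have vp: "0 < v p" and vq: "0 < v q" using v_pos assms by auto
  have rel: "u - ?W = ?M * v p" "u - wave p q - ?W = ?M * v q"
    using M(3) by (auto simp: algebra_simps)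
  have Z: "mass_flux K (p, u) ?W = - ?M" "mass_flux K (q, u - wave p q) ?W = - ?M"
    unfolding mass_flux_def fst_conv snd_conv rel using vp vq by auto
  have "g q - g p < 1 / 2 * (?M\<^sup>2 * (v p - v q)) * (v q + v p)"
    using gibbs_lt_trapezoid[OF assms] M(2) by simp
  also have "\<dots> = 1 / 2 * (?M * v p)\<^sup>2 - 1 / 2 * (?M * v q)\<^sup>2"
    by (simp add: power2_eq_square field_simps)
  finally have "total_gibbs K (q, u - wave p q) ?W - total_gibbs K (p, u) ?W \<le> 0"
    unfolding total_gibbs_def fst_conv snd_conv rel by simp
  with M(1) have "- ?M * (total_gibbs K (q, u - wave p q) ?W - total_gibbs K (p, u) ?W) \<ge> 0"
    by (simp add: mult_nonneg_nonpos)
  then show ?thesis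
    using assms M(4) by (auto simp: shock_def discontinuity_def Let_def Z)
qed

lemma right_shock:
  assumes "m \<le> p" "p < q"
  shows "shock K (q, u + wave p q) (p, u) (u + wave p q + shock_flux p q * v q)"
  using left_shock[OF assms, of "- u"]
    shock_reflect[of K "(p, u)" "(q, u + wave p q)" "u + wave p q + shock_flux p q * v q"]
  by (simp add: algebra_simps)

text \<open>\<open>W < u1\<close> fixes the sign of the mass flux. With it, entropy asserts the
  trapezoid inequality between \<open>p\<close> and \<open>q\<close>, which convexity reverses if
  \<open>q < p\<close>.\<close>

lemma left_shock_only:
  assumes "shock K (p, u) (q, u1) W" "m \<le> p" "m \<le> q" "W < u1"
  shows "p < q" "u1 = u - wave p q"
proof -
  define M where "M = - mass_flux K (p, u) W"
  have vp: "0 < v p" and vq: "0 < v q" using v_pos assms by auto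
  have Z: "mass_flux K (p, u) W = - M" "mass_flux K (q, u1) W = - M"
    and mom: "M * (u1 - u) + (q - p) = 0"
    and ent: "M * (total_gibbs K (q, u1) W - total_gibbs K (p, u) W) \<le> 0"
    and ne: "(p, u) \<noteq> (q, u1)"
    using assms(1) by (auto simp: shock_def discontinuity_def Let_def M_def)
  have rel: "u - W = M * v p" "u1 - W = M * v q"
    using Z vp vq by (auto simp: mass_flux_def field_simps)
  have M: "0 < M" using rel(2) assms(4) vq by (metis diff_gt_0_iff_gt zero_less_mult_pos2)
  have du: "u1 - u = - (M * (v p - v q))" using rel by (simp add: algebra_simps)
  then have dp: "q - p = M\<^sup>2 * (v p - v q)" using mom by (simp add: power2_eq_square)
  have "total_gibbs K (q, u1) W \<le> total_gibbs K (p, u) W"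
    using ent M by (simp add: mult_le_0_iff)
  then have "g q - g p \<le> 1 / 2 * (M\<^sup>2 * (v p - v q)) * (v q + v p)"
    by (simp add: total_gibbs_def rel power2_eq_square field_simps)
  then have trap: "g q - g p \<le> 1 / 2 * (q - p) * (v q + v p)"
    by (simp add: dp)
  show pq: "p < q"
  proof (rule ccontr)
    assume "\<not> p < q"
    moreover have "p \<noteq> q" using ne du by auto
    ultimately have "q < p" by simp
    from gibbs_lt_trapezoid[OF assms(3) this] trap show False
      by (simp add: algebra_simps)
  qed
  have "0 < M * (v p - v q)"
    using M v_strict_antimono[OF assms(2) pq] by simp
  moreover have "(q - p) * (v p - v q) = (M * (v p - v q))\<^sup>2"
    by (simp add: dp power2_eq_square)
  ultimately have "wave p q = M * (v p - v q)"
    using pq by (simp add: wave_def)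
  with du show "u1 = u - wave p q" by simp
qed

lemma right_shock_only:
  assumes "shock K (q, u2) (p, u) W" "m \<le> p" "m \<le> q" "u2 < W"
  shows "p < q" "u2 = u + wave p q"
proof -
  have "shock K (p, - u) (q, - u2) (- W)"
    using shock_reflect[of K "(p, u)" "(q, u2)" W] assms(1) by simp
  from left_shock_only[OF this assms(2,3)] assms(4) show "p < q" "u2 = u + wave p q"
    by auto
qed

section \<open>Rarefaction fans\<close>

lemma fan_interior_deriv:
  assumes euler: "self_similar_Euler (\<lambda>y. 1 / v (P y)) U P x"
    and I: "open I" "x \<in> I" and P: "\<And>y. y \<in> I \<Longrightarrow> m \<le> P y"
    and char: "x = U x + s * a (P x)" and s: "s \<in> {-1, 1}"
  obtains dP where "(P has_real_derivative dP) (at x)"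
    "(U has_real_derivative s * admittance (P x) * dP) (at x)"
proof -
  define R where "R y = 1 / v (P y)" for y
  from euler obtain dR dM dF where
    dR: "(R has_real_derivative dR) (at x)" and
    dM: "((\<lambda>y. R y * U y) has_real_derivative dM) (at x)" and
    dF: "((\<lambda>y. R y * (U y)\<^sup>2 + P y) has_real_derivative dF) (at x)" and
    mass: "- x * dR + dM = 0" and mom: "- x * dM + dF = 0"
    unfolding self_similar_Euler_def R_def[symmetric] by (auto simp: R_def[abs_def])
  have Rpos: "0 < R y" if "y \<in> I" for y
    using P[OF that] by (simp add: R_def v_pos)
  define dU where "dU = (dM - U x * dR) / R x"
  \<comment> \<open>Only the conserved quantities are known to be differentiable. \<open>U\<close>
    is recovered as momentum over density, and \<open>P\<close> below as the momentum flux minus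
    \<open>(R * U) * U\<close>.\<close>
  have "((\<lambda>y. R y * U y / R y) has_real_derivative
      (dM * R x - R x * U x * dR) / (R x * R x)) (at x)"
    using Rpos[OF I(2)] by (intro DERIV_divide dM dR) auto
  then have "(U has_real_derivative (dM * R x - R x * U x * dR) / (R x * R x)) (at x)"
    by (rule has_field_derivative_transform_within_open[OF _ I]) (use Rpos in fastforce)
  moreover have "(dM * R x - R x * U x * dR) / (R x * R x) = dU"
    using Rpos[OF I(2)] by (simp add: dU_def field_simps)
  ultimately have dU: "(U has_real_derivative dU) (at x)" by simp
  have "((\<lambda>y. (R y * (U y)\<^sup>2 + P y) - (R y * U y) * U y) has_real_derivative
      dF - (dM * U x + dU * (R x * U x))) (at x)"
    by (intro DERIV_diff dF DERIV_mult dM dU)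
  then have dP: "(P has_real_derivative dF - (dM * U x + dU * (R x * U x))) (at x)"
    by (simp add: power2_eq_square mult.assoc)
  have "R x * dU = dM - U x * dR"
    using Rpos[OF I(2)] by (simp add: dU_def)
  also have "\<dots> = (x - U x) * dR"
    using mass by (simp add: algebra_simps)
  finally have RdU': "R x * dU = (x - U x) * dR" .
  moreover have "x - U x = s * a (P x)"
    using char by linarith
  ultimately have RdU: "R x * dU = s * a (P x) * dR" by simp
  \<comment> \<open>Both Euler equations express everything through \<open>dR\<close>, with
    \<open>dM = x * dR\<close> and \<open>dF = x * dM\<close>; the characteristic condition then
    turns \<open>(x - U x)^2\<close> into \<open>a^2\<close>.\<close>
  have "dF - (dM * U x + dU * (R x * U x)) = (x - U x)\<^sup>2 * dR"
  proof -
    have "dF = x * (x * dR)" "dM = x * dR" using mass mom by auto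
    moreover have "dU * (R x * U x) = (x - U x) * dR * U x"
      by (simp flip: RdU')
    ultimately show ?thesis by (simp add: power2_eq_square algebra_simps)
  qed
  also have "\<dots> = (a (P x))\<^sup>2 * dR"
    using \<open>x - U x = s * a (P x)\<close> s by auto
  finally have dP': "dF - (dM * U x + dU * (R x * U x)) = (a (P x))\<^sup>2 * dR" .
  have "dU = s * a (P x) * dR * v (P x)"
    using RdU v_pos[OF P[OF I(2)]] by (simp add: R_def field_simps)
  also have "\<dots> = s * admittance (P x) * ((a (P x))\<^sup>2 * dR)"
    using a_pos[OF P[OF I(2)]] by (simp add: admittance_def power2_eq_square)
  finally show thesis
    using that dP dU unfolding dP' by metis
qed

text \<open>\<open>U - s * riemann P\<close> has zero derivative inside the fan and is continuous up
  to its edges. Given this invariant, \<open>x1 \<le> x2\<close> says that the characteristic speed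
  does not decrease from left to right, which orders the pressures.\<close>

lemma fan_states:
  assumes fan: "rarefaction K m s Sl Sr x1 x2" and s: "s \<in> {-1, 1}"
  shows "x1 = snd Sl + s * a (fst Sl)" "x2 = snd Sr + s * a (fst Sr)"
    "m \<le> fst Sl" "m \<le> fst Sr" "s * fst Sl \<le> s * fst Sr"
    "snd Sr - snd Sl = s * (riemann (fst Sr) - riemann (fst Sl))"
proof -
  from fan obtain P U where le: "x1 \<le> x2"
    and Sl: "Sl = (P x1, U x1)" and Sr: "Sr = (P x2, U x2)"
    and cP: "continuous_on {x1..x2} P" and cU: "continuous_on {x1..x2} U"
    and P: "\<And>x. x1 \<le> x \<Longrightarrow> x \<le> x2 \<Longrightarrow> m \<le> P x"
    and char: "\<And>x. x1 \<le> x \<Longrightarrow> x \<le> x2 \<Longrightarrow> x = U x + s * a (P x)"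
    and euler: "\<And>x. x1 < x \<Longrightarrow> x < x2 \<Longrightarrow> self_similar_Euler (\<lambda>y. 1 / v (P y)) U P x"
    unfolding rarefaction_def by (metis atLeastAtMost_iff greaterThanLessThan_iff)
  show x1: "x1 = snd Sl + s * a (fst Sl)" and x2: "x2 = snd Sr + s * a (fst Sr)"
    and ml: "m \<le> fst Sl" and mr: "m \<le> fst Sr"
    using P[of x1] P[of x2] char[of x1] char[of x2] le by (auto simp: Sl Sr)
  let ?I = "\<lambda>x. U x - s * riemann (P x)"
  have "?I x2 = ?I x1"
  proof (cases "x1 = x2")
    case False
    with le have lt: "x1 < x2" by simp
    show ?thesis
    proof (rule DERIV_isconst2[OF lt])
      have "continuous_on {x1..x2} (\<lambda>x. riemann (P x))"
        by (rule continuous_on_compose2[OF riemann_continuous cP]) (use P in auto)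
      then show "continuous_on {x1..x2} ?I"
        by (intro continuous_intros cU)
      show "DERIV ?I x :> 0" if x: "x1 < x" "x < x2" for x
      proof -
        from x P char obtain dP where dP: "(P has_real_derivative dP) (at x)"
          and dU: "(U has_real_derivative s * admittance (P x) * dP) (at x)"
          using fan_interior_deriv[OF euler[OF x], of "{x1<..<x2}" s] s by auto
        \<comment> \<open>\<open>P x\<close> may equal \<open>m\<close> inside the fan, where
          \<open>riemann\<close> has only a one-sided derivative; hence the chain rule relative to
          the image of \<open>P\<close>.\<close>
        have "(riemann has_real_derivative admittance (P x)) (at (P x) within P ` {x1<..<x2})"
          by (rule has_field_derivative_subset[OF riemann_deriv_within]) (use P x in auto)
        then have "(riemann \<circ> P has_real_derivative admittance (P x) * dP)
            (at x within {x1<..<x2})"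
          by (rule DERIV_image_chain) (use dP has_field_derivative_at_within in blast)
        then have "((\<lambda>x. riemann (P x)) has_real_derivative admittance (P x) * dP) (at x)"
          using x by (simp add: at_within_open[of x "{x1<..<x2}"] o_def)
        then have "DERIV ?I x :> s * admittance (P x) * dP - s * (admittance (P x) * dP)"
          by (intro DERIV_diff dU DERIV_cmult)
        then show ?thesis by simp
      qed
    qed (use le in auto)
  qed simp
  then show inv: "snd Sr - snd Sl = s * (riemann (fst Sr) - riemann (fst Sl))"
    by (simp add: Sl Sr algebra_simps)
  have "x2 - x1 = s * ((riemann (fst Sr) + a (fst Sr)) - (riemann (fst Sl) + a (fst Sl)))"
    using x1 x2 inv by (simp add: algebra_simps)
  then have *: "0 \<le> s * ((riemann (fst Sr) + a (fst Sr)) - (riemann (fst Sl) + a (fst Sl)))"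
    using le by linarith
  show "s * fst Sl \<le> s * fst Sr"
  proof (cases "s = 1")
    case True
    then show ?thesis
      using * riemann_plus_a_strict_mono[OF mr, of "fst Sl"] by (cases "fst Sr < fst Sl") auto
  next
    case False
    then have "s = -1" using s by auto
    then show ?thesis
      using * riemann_plus_a_strict_mono[OF ml, of "fst Sr"] by (cases "fst Sl < fst Sr") auto
  qed
qed

text \<open>Multiplying \<open>x = U + s * a P\<close> by \<open>s\<close> and inserting the Riemann
  invariant gives \<open>riemann P + a P = s * x - s * U1 + riemann P1\<close>. The left side is
  strictly increasing in \<open>P\<close>, so its inverse defines the fan. For
  \<open>P1 = P2\<close> the fan degenerates to a point.\<close>

lemma fan_exists:
  fixes P1 P2 U1 s :: real
  assumes s: "s \<in> {-1, 1}" and "m < P1" "m < P2" and ord: "s * P1 \<le> s * P2"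
  defines "U2 \<equiv> U1 + s * (riemann P2 - riemann P1)"
  shows "rarefaction K m s (P1, U1) (P2, U2) (U1 + s * a P1) (U2 + s * a P2)"
proof -
  define x1 x2 where "x1 = U1 + s * a P1" and "x2 = U2 + s * a P2"
  define H where "H p = riemann p + a p" for p
  define lo hi where "lo = min P1 P2" and "hi = max P1 P2"
  define J where "J = inv_into {lo..hi} H"
  define t where "t x = s * x - s * U1 + riemann P1" for x
  define P where "P x = J (t x)" for x
  define U where "U x = U1 + s * (riemann (P x) - riemann P1)" for x
  have lo: "m < lo" "lo \<le> hi" using assms by (auto simp: lo_def hi_def)
  have ss: "s * s = 1" using s by auto
  have Hmono: "H p < H q" if "lo \<le> p" "p < q" for p q
    using riemann_plus_a_strict_mono[of p q] that lo by (simp add: H_def)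
  then have Hle: "H p \<le> H q" if "lo \<le> p" "p \<le> q" for p q
    using that by (cases "p = q") (auto simp: less_imp_le)
  have inj: "inj_on H {lo..hi}"
    using Hmono by (auto simp: inj_on_def) (metis less_irrefl linorder_cases)
  have contH: "continuous_on {lo..hi} H"
    unfolding H_def by (rule continuous_on_subset[OF riemann_plus_a_continuous]) (use lo in auto)
  have img: "H ` {lo..hi} = {H lo..H hi}"
  proof
    show "H ` {lo..hi} \<subseteq> {H lo..H hi}" using Hle by auto
    show "{H lo..H hi} \<subseteq> H ` {lo..hi}"
      using IVT'[OF _ _ lo(2) contH] by fastforce
  qed
  have HJ: "H (J y) = y" "lo \<le> J y" "J y \<le> hi" if "y \<in> {H lo..H hi}" for y
  proof -
    from that img have y: "y \<in> H ` {lo..hi}" by simp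
    show "H (J y) = y" unfolding J_def by (rule f_inv_into_f[OF y])
    show "lo \<le> J y" "J y \<le> hi" using inv_into_into[OF y] by (auto simp: J_def)
  qed
  have JH: "J (H p) = p" if "p \<in> {lo..hi}" for p
    unfolding J_def by (rule inv_into_f_f[OF inj that])
  have contJ: "continuous_on {H lo..H hi} J"
    unfolding img[symmetric] by (rule continuous_on_inv[OF contH]) (auto simp: JH)
  have t1: "t x1 = H P1" and t2: "t x2 = H P2"
    using s by (auto simp: t_def x1_def x2_def U2_def H_def)
  have range: "t x \<in> {H lo..H hi}" if "x1 \<le> x" "x \<le> x2" for x
  proof (cases "s = 1")
    case True
    with ord have "lo = P1" "hi = P2" by (auto simp: lo_def hi_def)
    with t1 t2 that True show ?thesis by (simp add: t_def)
  next
    case False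
    with s have s: "s = -1" by auto
    with ord have "lo = P2" "hi = P1" by (auto simp: lo_def hi_def)
    with t1 t2 that s show ?thesis by (simp add: t_def)
  qed
  have range': "H lo < t x" "t x < H hi" if "x1 < x" "x < x2" for x
  proof -
    have "(s = 1 \<and> lo = P1 \<and> hi = P2) \<or> (s = -1 \<and> lo = P2 \<and> hi = P1)"
      using s ord by (auto simp: lo_def hi_def)
    then show "H lo < t x" "t x < H hi"
      using t1 t2 that by (auto simp: t_def)
  qed
  have x12: "x1 \<le> x2"
  proof -
    have "x2 - x1 = s * (H P2 - H P1)"
      by (simp add: x1_def x2_def U2_def H_def algebra_simps)
    moreover have "0 \<le> s * (H P2 - H P1)"
      using s ord Hle[of P1 P2] Hle[of P2 P1] by (auto simp: lo_def)
    ultimately show ?thesis by simp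
  qed
  have P: "H (P x) = t x" "lo \<le> P x" "P x \<le> hi" if "x1 \<le> x" "x \<le> x2" for x
    using HJ[OF range[OF that]] by (auto simp: P_def)
  have ends: "P x1 = P1" "P x2 = P2"
    using t1 t2 JH by (auto simp: P_def lo_def hi_def)
  then have endsU: "U x1 = U1" "U x2 = U2"
    by (auto simp: U_def U2_def)
  have char: "x = U x + s * a (P x)" if "x1 \<le> x" "x \<le> x2" for x
  proof -
    have "s * H (P x) = s * t x" using P[OF that] by simp
    then have "s * H (P x) = x - U1 + s * riemann P1"
      using s by (auto simp: t_def)
    then show ?thesis by (simp add: U_def H_def algebra_simps)
  qed
  have contP: "continuous_on {x1..x2} P"
    unfolding P_def
    by (rule continuous_on_compose2[OF contJ]) (use range in \<open>auto simp: t_def intro!: continuous_intros\<close>)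
  have contU: "continuous_on {x1..x2} U"
    unfolding U_def
    by (intro continuous_intros continuous_on_compose2[OF riemann_continuous contP])
      (use P lo in force)
  have euler: "self_similar_Euler (\<lambda>y. 1 / v (P y)) U P x" if x: "x1 < x" "x < x2" for x
  proof -
    note Px = P[of x]
    have mP: "m < P x" using Px x lo by simp
    obtain D where D: "(H has_real_derivative D) (at (P x))" "0 < D"
      using riemann_plus_a_deriv[OF mP] unfolding H_def by blast
    have "isCont J (t x)"
      by (rule continuous_on_interior[OF contJ]) (use range'[OF x] in simp)
    then have "(J has_real_derivative inverse D) (at (t x))"
      using D HJ range'[OF x]
      by (intro DERIV_inverse_function[of H D J "t x" "H lo" "H hi"]) (auto simp: P_def)
    moreover have "(t has_real_derivative s) (at x)"
      unfolding t_def by (auto intro!: derivative_eq_intros)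
    ultimately have dP: "(P has_real_derivative inverse D * s) (at x)"
      unfolding P_def by (rule DERIV_chain2)
    define d where "d = inverse D * s"
    define V A where "V = v (P x)" and "A = a (P x)"
    have pos: "0 < V" "0 < A" using mP v_pos a_pos by (auto simp: V_def A_def)
    have "((\<lambda>y. riemann (P y)) has_real_derivative admittance (P x) * d) (at x)"
      using DERIV_chain2[OF riemann_deriv[OF mP] dP] by (simp add: d_def)
    then have "(U has_real_derivative s * (admittance (P x) * d)) (at x)"
      unfolding U_def by (auto intro!: derivative_eq_intros)
    then have dU: "(U has_real_derivative s * (V / A * d)) (at x)"
      by (simp add: admittance_def V_def A_def)
    have dv: "((\<lambda>y. v (P y)) has_real_derivative - (V / A)\<^sup>2 * d) (at x)"
      using DERIV_chain2[OF v_deriv[OF mP] dP] by (simp add: d_def admittance_def V_def A_def)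
    have dR: "((\<lambda>y. 1 / v (P y)) has_real_derivative d / A\<^sup>2) (at x)"
      using dv pos
      by (auto intro!: derivative_eq_intros simp: V_def[symmetric] field_simps power2_eq_square)
    note dM = DERIV_mult[OF dR dU]
    note dF = DERIV_add[OF DERIV_mult[OF dM dU] dP[folded d_def]]
    have char: "x = U x + s * A"
      using char[of x] x by (simp add: A_def)
    have mass: "- x * (d / A\<^sup>2) + (d / A\<^sup>2 * U x + s * (V / A * d) * (1 / v (P x))) = 0"
      using pos by (subst (1) char) (simp add: V_def[symmetric] field_simps power2_eq_square)
    \<comment> \<open>The momentum residual is split into \<open>U x\<close> times the mass residual
      and a remainder that vanishes because \<open>x - U x = s * A\<close> and
      \<open>s * s = 1\<close>.\<close>
    have "- x * (d / A\<^sup>2 * U x + s * (V / A * d) * (1 / v (P x))) +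
        ((d / A\<^sup>2 * U x + s * (V / A * d) * (1 / v (P x))) * U x +
          s * (V / A * d) * (1 / v (P x) * U x) + d) = 
        U x * (- x * (d / A\<^sup>2) + (d / A\<^sup>2 * U x + s * (V / A * d) * (1 / v (P x)))) +
        (d - (x - U x) * (s * (V / A * d) * (1 / v (P x))))"
      by (simp add: algebra_simps add_divide_distrib diff_divide_distrib)
    also have "(x - U x) * (s * (V / A * d) * (1 / v (P x))) = (s * s) * d"
    proof -
      have "x - U x = s * A" using char by linarith
      then show ?thesis using pos by (simp add: V_def[symmetric])
    qed
    finally have mom: "- x * (d / A\<^sup>2 * U x + s * (V / A * d) * (1 / v (P x))) +
        ((d / A\<^sup>2 * U x + s * (V / A * d) * (1 / v (P x))) * U x +
          s * (V / A * d) * (1 / v (P x) * U x) + d) = 0"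
      unfolding mass ss by simp
    show ?thesis
      unfolding self_similar_Euler_def power2_eq_square mult.assoc[symmetric]
      using dR dM dF mass mom
      by (intro exI conjI) (assumption | simp add: mult.assoc)+
  qed
  have "rarefaction K m s (P1, U1) (P2, U2) x1 x2"
    unfolding rarefaction_def
  proof (intro conjI exI)
    show "(P x1, U x1) = (P1, U1)" "(P x2, U x2) = (P2, U2)"
      using ends endsU by auto
    show "\<forall>x\<in>{x1..x2}. m \<le> P x \<and> x = U x + s * a (P x)"
      using P lo char by force
    show "\<forall>x\<in>{x1<..<x2}. self_similar_Euler (\<lambda>y. 1 / v (P y)) U P x"
      using euler by auto
  qed (rule x12 contP contU)+
  then show ?thesis by (simp add: x1_def x2_def)
qed

end

section \<open>Two phases\<close>

text \<open>A pointwise version: \<open>F\<close> is differentiable at one point only, and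
  continuity of the implicit function is an input. The linearized equation first bounds the
  increment of \<open>f\<close> linearly, after which the remainder is small relative to
  \<open>y - x\<close>.\<close>

lemma implicit_function_deriv:
  fixes F :: "real \<times> real \<Rightarrow> real" and f :: "real \<Rightarrow> real"
  assumes F: "(F has_derivative (\<lambda>(s, t). A * s + B * t)) (at (x, f x))"
    and B: "B \<noteq> 0" and f: "isCont f x"
    and zero: "\<forall>\<^sub>F y in nhds x. F (y, f y) = 0"
  shows "(f has_real_derivative - A / B) (at x)"
proof -
  have F0: "F (x, f x) = 0" using zero by (rule eventually_nhds_x_imp_x)
  define K where "K = 2 * (\<bar>A\<bar> + \<bar>B\<bar>) / \<bar>B\<bar>"
  have K: "0 \<le> K" by (simp add: K_def)
  have bound: "\<forall>\<^sub>F y in at x. \<bar>f y - f x + A / B * (y - x)\<bar> \<le> e * \<bar>y - x\<bar>" if e: "0 < e" for e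
  proof -
    \<comment> \<open>The bound \<open>\<bar>B\<bar> / 2\<close> lets the
      \<open>\<bar>t\<bar>\<close> term of the error be absorbed, giving
      \<open>\<bar>t\<bar> \<le> K * \<bar>s\<bar>\<close>; the other bound then makes the total
      error at most \<open>e * \<bar>B\<bar> * \<bar>s\<bar>\<close>.\<close>
    define d where "d = min (\<bar>B\<bar> / 2) (e * \<bar>B\<bar> / (1 + K))"
    have d: "0 < d" "d \<le> \<bar>B\<bar> / 2" "d * (1 + K) \<le> e * \<bar>B\<bar>"
    proof -
      show "0 < d" using e B K by (auto simp: d_def)
      show "d \<le> \<bar>B\<bar> / 2" unfolding d_def by (rule min.cobounded1)
      have "d \<le> e * \<bar>B\<bar> / (1 + K)" by (simp add: d_def)
      then show "d * (1 + K) \<le> e * \<bar>B\<bar>" using K by (simp add: pos_le_divide_eq)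
    qed
    have "\<forall>\<^sub>F p in nhds (x, f x).
        norm (F p - F (x, f x) - (case p - (x, f x) of (s, t) \<Rightarrow> A * s + B * t)) \<le> d * norm (p - (x, f x))"
      using F d(1) unfolding has_derivative_at_alt eventually_nhds_metric dist_norm by blast
    moreover have "filterlim (\<lambda>y. (y, f y)) (nhds (x, f x)) (at x)"
      using f by (intro tendsto_Pair tendsto_ident_at) (simp add: isCont_def)
    ultimately have "\<forall>\<^sub>F y in at x.
        norm (F (y, f y) - F (x, f x) - (case (y, f y) - (x, f x) of (s, t) \<Rightarrow> A * s + B * t))
          \<le> d * norm ((y, f y) - (x, f x))"
      by (rule eventually_compose_filterlim)
    moreover have "\<forall>\<^sub>F y in at x. F (y, f y) = 0"
      using zero by (auto simp: eventually_at_filter elim: eventually_mono)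
    ultimately show ?thesis
    proof eventually_elim
      case (elim y)
      define s t where "s = y - x" and "t = f y - f x"
      have "norm ((y, f y) - (x, f x)) \<le> \<bar>s\<bar> + \<bar>t\<bar>"
        using norm_Pair_le[of s t] by (simp add: s_def t_def)
      then have "d * norm ((y, f y) - (x, f x)) \<le> d * (\<bar>s\<bar> + \<bar>t\<bar>)"
        using d(1) by (intro mult_left_mono) auto
      with elim F0 have est: "\<bar>A * s + B * t\<bar> \<le> d * (\<bar>s\<bar> + \<bar>t\<bar>)"
        by (simp add: s_def t_def)
      have "\<bar>B\<bar> * \<bar>t\<bar> \<le> \<bar>A\<bar> * \<bar>s\<bar> + d * (\<bar>s\<bar> + \<bar>t\<bar>)"
        using est abs_triangle_ineq4[of "A * s + B * t" "A * s"] by (simp add: abs_mult)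
      also have "d * (\<bar>s\<bar> + \<bar>t\<bar>) \<le> \<bar>B\<bar> / 2 * (\<bar>s\<bar> + \<bar>t\<bar>)"
        using d by (intro mult_right_mono) auto
      finally have "\<bar>B\<bar> * \<bar>t\<bar> \<le> \<bar>A\<bar> * \<bar>s\<bar> + \<bar>B\<bar> / 2 * (\<bar>s\<bar> + \<bar>t\<bar>)"
        by simp
      moreover have "0 \<le> \<bar>A\<bar> * \<bar>s\<bar>" "0 \<le> \<bar>B\<bar> * \<bar>s\<bar>"
        "\<bar>B\<bar> / 2 * (\<bar>s\<bar> + \<bar>t\<bar>) = \<bar>B\<bar> * \<bar>s\<bar> / 2 + \<bar>B\<bar> * \<bar>t\<bar> / 2"
        "(2 * (\<bar>A\<bar> + \<bar>B\<bar>)) * \<bar>s\<bar> = 2 * (\<bar>A\<bar> * \<bar>s\<bar>) + 2 * (\<bar>B\<bar> * \<bar>s\<bar>)"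
        by (simp_all add: field_simps)
      ultimately have "\<bar>B\<bar> * \<bar>t\<bar> \<le> (2 * (\<bar>A\<bar> + \<bar>B\<bar>)) * \<bar>s\<bar>"
        by linarith
      then have "\<bar>t\<bar> \<le> K * \<bar>s\<bar>"
        using B by (simp add: K_def field_simps)
      then have "d * (\<bar>s\<bar> + \<bar>t\<bar>) \<le> d * ((1 + K) * \<bar>s\<bar>)"
        using d by (intro mult_left_mono) (auto simp: algebra_simps)
      also have "\<dots> \<le> e * \<bar>B\<bar> * \<bar>s\<bar>"
        using mult_right_mono[OF d(3), of "\<bar>s\<bar>"] by (simp add: mult.assoc)
      finally have "\<bar>A * s + B * t\<bar> \<le> \<bar>B\<bar> * (e * \<bar>s\<bar>)"
        using est by (simp add: mult_ac)
      moreover have "A * s + B * t = B * (t + A / B * s)"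
        using B by (simp add: field_simps)
      ultimately have "\<bar>B\<bar> * \<bar>t + A / B * s\<bar> \<le> \<bar>B\<bar> * (e * \<bar>s\<bar>)"
        by (simp add: abs_mult)
      then show ?case
        using B by (simp add: s_def t_def)
    qed
  qed
  show ?thesis
    unfolding has_field_derivative_iff
  proof (rule tendstoI)
    fix e :: real assume "0 < e"
    then have "\<forall>\<^sub>F y in at x. \<bar>f y - f x + A / B * (y - x)\<bar> \<le> e / 2 * \<bar>y - x\<bar>"
      by (intro bound) simp
    moreover have "\<forall>\<^sub>F y in at x. y \<noteq> x"
      by (simp add: eventually_at_filter)
    ultimately show "\<forall>\<^sub>F y in at x. dist ((f y - f x) / (y - x)) (- A / B) < e"
    proof eventually_elim
      case (elim y)
      have "(f y - f x) / (y - x) - (- A / B) = (f y - f x + A / B * (y - x)) / (y - x)"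
        using elim by (simp add: field_simps)
      then have "dist ((f y - f x) / (y - x)) (- A / B) = \<bar>f y - f x + A / B * (y - x)\<bar> / \<bar>y - x\<bar>"
        by (simp add: dist_real_def)
      also have "\<dots> \<le> e / 2"
        using elim by (simp add: pos_divide_le_eq)
      finally show ?case using \<open>0 < e\<close> by simp
    qed
  qed
qed

text \<open>The normalized form of \<open>0 < f\<^sub>z'\<close>, where \<open>g = (1 - \<alpha>) \<gamma>\<^sub>V\<close>, \<open>G = (1 - v\<^sub>L / v\<^sub>V) \<gamma>\<^sub>V\<close> and
  \<open>k = z p \<tau> (v\<^sub>V - v\<^sub>L)\<^sup>2\<close>.\<close>

lemma slope_inequality:
  fixes x y k g G ab C1 C2 \<phi>' :: real
  assumes x: "0 < x" "x < 1" and y: "0 < y" and xy: "x \<le> y" and ab: "ab < 1"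
    and g: "0 < g" "g \<le> G" "G \<le> 1" and k: "0 < k" "(1 - g) * y \<le> k"
    and \<phi>': "\<phi>' = ((1 - y\<^sup>2) * (1 - k) + 2 * y\<^sup>2 * G) / ((1 - x\<^sup>2) * (1 + k))"
    and C: "x \<le> C1" "x \<le> C2" "C1 \<le> ab * y" "C2 \<le> ab * y"
  shows "0 < (C1 + C2) * \<phi>' + (1 + y\<^sup>2 - (1 + x\<^sup>2) * \<phi>')"
proof -
  define N where "N = (1 - y\<^sup>2) * (1 - k) + 2 * y\<^sup>2 * G"
  have x2: "0 < 1 - x\<^sup>2" using x by (simp add: power_less_one_iff abs_square_less_1)
  then have den: "0 < (1 - x\<^sup>2) * (1 + k)" using k by simp
  have "\<phi>' = N / ((1 - x\<^sup>2) * (1 + k))"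
    by (simp only: \<phi>' N_def)
  then have N: "N = \<phi>' * ((1 - x\<^sup>2) * (1 + k))"
    using den by (metis less_irrefl nonzero_eq_divide_eq)
  have y2: "0 < 1 + y\<^sup>2" by (simp add: add_pos_nonneg)
  show ?thesis
  proof (cases "0 \<le> \<phi>'")
    case True
    \<comment> \<open>For \<phi>' \<ge> 0 the lower bounds \<open>x \<le> C1\<close> and
      \<open>x \<le> C2\<close> reduce the claim to \<open>\<phi>' * (1 - x)^2 < 1 + y^2\<close>.
      The bound with \<open>1 - x^2\<close> in place of \<open>(1 - x)^2\<close> follows from
      \<open>G \<le> 1\<close>, and \<open>0 < x < 1\<close> makes it strict.\<close>
    have "2 * y\<^sup>2 * G \<le> 2 * y\<^sup>2" using g by (simp add: mult_left_le)
    then have "N \<le> 1 - k + y\<^sup>2 + k * y\<^sup>2" by (simp add: N_def algebra_simps)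
    also have "\<dots> \<le> (1 + y\<^sup>2) * (1 + k)" using k by (simp add: algebra_simps)
    finally have "\<phi>' * (1 - x\<^sup>2) * (1 + k) \<le> (1 + y\<^sup>2) * (1 + k)" by (simp add: N mult_ac)
    then have le: "\<phi>' * (1 - x\<^sup>2) \<le> 1 + y\<^sup>2" using k by simp
    have "\<phi>' * (1 - x)\<^sup>2 < 1 + y\<^sup>2"
    proof (cases "\<phi>' = 0")
      case False
      then have "\<phi>' * (1 - x)\<^sup>2 < \<phi>' * (1 - x\<^sup>2)"
        using True x by (intro mult_strict_left_mono) (auto simp: power2_eq_square algebra_simps)
      with le show ?thesis by simp
    qed (use y2 in simp)
    moreover have "(x + x) * \<phi>' \<le> (C1 + C2) * \<phi>'"
      using True C by (intro mult_right_mono) auto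
    ultimately show ?thesis by (simp add: power2_eq_square algebra_simps)
  next
    case False
    then have Nneg: "N < 0" using den by (simp add: N mult_neg_pos)
    have "y < 1"
    proof (rule ccontr)
      assume "\<not> y < 1"
      then have y1: "1 \<le> y" by simp
      then have y12: "0 \<le> y\<^sup>2 - 1" by simp
      \<comment> \<open>For \<open>y \<ge> 1\<close>, \<open>N\<close> increases with
        \<open>k\<close> and \<open>G\<close>, so these may be replaced by
        \<open>(1 - g) * y\<close> and \<open>g\<close>. The resulting polynomial is this manifestly
        nonnegative combination.\<close>
      have "0 \<le> (1 - g) * ((y - 1)\<^sup>2 * (y + 1)) + g * (y\<^sup>2 + 1)"
        using y1 g by (intro add_nonneg_nonneg mult_nonneg_nonneg) auto
      also have "\<dots> = (y\<^sup>2 - 1) * ((1 - g) * y - 1) + 2 * y\<^sup>2 * g"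
        by (simp add: power2_eq_square algebra_simps)
      also have "\<dots> \<le> (y\<^sup>2 - 1) * (k - 1) + 2 * y\<^sup>2 * G"
        using y12 k g by (intro add_mono mult_left_mono) auto
      also have "\<dots> = N" by (simp add: N_def algebra_simps)
      finally show False using Nneg by simp
    qed
    then have y21: "y\<^sup>2 \<le> 1" using y by (simp add: power_le_one)
    \<comment> \<open>Discarding the \<open>G\<close> term and comparing \<open>1 - y^2\<close> with
      \<open>1 - x^2\<close> gives \<phi>' \<ge> -1.\<close>
    have "- N \<le> (1 - y\<^sup>2) * (k - 1)"
      using g by (simp add: N_def algebra_simps)
    also have "\<dots> \<le> (1 - y\<^sup>2) * (k + 1)" using y21 by (intro mult_left_mono) auto
    also have "\<dots> \<le> (1 - x\<^sup>2) * (k + 1)"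
      using k xy x by (intro mult_right_mono) (auto intro: power_mono)
    finally have "- \<phi>' * ((1 - x\<^sup>2) * (1 + k)) \<le> 1 * ((1 - x\<^sup>2) * (1 + k))"
      by (simp add: N algebra_simps)
    then have \<phi>1: "- \<phi>' \<le> 1" using den by (simp only: mult_le_cancel_right_pos)
    have Cy: "C1 + C2 \<le> 2 * y" using C ab y mult_right_mono[of ab 1 y] by linarith
    have "2 * y - 1 \<le> y\<^sup>2"
      using zero_le_power2[of "y - 1"] by (simp add: power2_eq_square algebra_simps)
    then have less: "C1 + C2 - 1 - x\<^sup>2 < 1 + y\<^sup>2" using Cy by (smt (verit) zero_le_power2)
    have "- \<phi>' * (C1 + C2 - 1 - x\<^sup>2) < 1 + y\<^sup>2"
    proof (cases "0 \<le> C1 + C2 - 1 - x\<^sup>2")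
      case True
      then have "- \<phi>' * (C1 + C2 - 1 - x\<^sup>2) \<le> 1 * (C1 + C2 - 1 - x\<^sup>2)"
        using \<phi>1 by (intro mult_right_mono)
      with less show ?thesis by simp
    next
      case neg: False
      then have "- \<phi>' * (C1 + C2 - 1 - x\<^sup>2) \<le> 0"
        using False by (simp add: mult_nonpos_nonpos)
      with y2 show ?thesis by linarith
    qed
    then show ?thesis by (simp add: algebra_simps)
  qed
qed

lemma DERIV_along_graph:
  fixes F :: "real \<times> real \<Rightarrow> real"
  assumes "(F has_derivative (\<lambda>(s, t). A * s + B * t)) (at (x, f x))"
    "(f has_real_derivative m) (at x)"
  shows "((\<lambda>y. F (y, f y)) has_real_derivative A + B * m) (at x)"
proof -
  have "((\<lambda>y. (y, f y)) has_derivative (\<lambda>h. (h, m * h))) (at x)"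
    using assms(2) by (auto intro!: derivative_eq_intros simp: has_field_derivative_def)
  from has_derivative_compose[OF this assms(1)]
  have "((\<lambda>y. F (y, f y)) has_derivative (\<lambda>h. A * h + B * (m * h))) (at x)" by simp
  moreover have "(\<lambda>h. A * h + B * (m * h)) = (*) (A + B * m)"
    by (simp add: fun_eq_iff algebra_simps)
  ultimately show ?thesis by (simp add: has_field_derivative_def)
qed

section \<open>Consequences of the constitutive bounds\<close>

locale two_phase_setting =
  fixes E :: two_phase and \<alpha> \<beta> :: real
  assumes fluid: "two_phase_fluid E"
    and bounds: "constitutive_bounds E \<alpha> \<beta>"
    and interface_unique: "\<And>p. p \<in> vapor_range E \<alpha> \<Longrightarrow> \<exists>!q. interface_pressure E p q"
begin

sublocale liq: convex_phase "liquid E" "pmin E"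
  by standard (use fluid in \<open>simp add: two_phase_fluid_def\<close>)

abbreviation "c \<equiv> liq.admittance"

text \<open>The vapor counterpart of \<open>liq.admittance\<close>. The vapor domain
  \<open>{0<..}\<close> is open, whereas \<open>convex_phase\<close> is set up on a closed
  half-line.\<close>

definition vap_admittance :: "real \<Rightarrow> real" where
  "vap_admittance p = vV E p / aV E p"

lemma pmin_le: "pmin E \<le> 0" and psat_pos: "0 < psat E" and tau_pos: "0 < tau E"
  and gibbs_psat: "gL E (psat E) = gV E (psat E)"
  using fluid by (auto simp: two_phase_fluid_def)

lemma alpha: "0 < \<alpha>" "\<alpha> < 1" and beta: "0 < \<beta>" "\<alpha> * \<beta> < 1"
  using bounds by (auto simp: constitutive_bounds_def)

lemma vapor_facts:
  assumes "0 < p"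
  shows "0 < vV E p" "0 < aV E p" "(vV E has_real_derivative - (vap_admittance p)\<^sup>2) (at p)"
    "(gV E has_real_derivative vV E p) (at p)"
proof -
  have at: "at p within {0<..} = at p" by (rule at_within_open) (use assms in auto)
  have "0 < vV E p \<and> 0 < aV E p \<and>
      (vV E has_real_derivative - (vap_admittance p)\<^sup>2) (at p within {0<..}) \<and>
      (gV E has_real_derivative vV E p) (at p within {0<..})"
    using fluid assms by (auto simp: two_phase_fluid_def regular_phase_def vap_admittance_def power_divide)
  then show "0 < vV E p" "0 < aV E p" "(vV E has_real_derivative - (vap_admittance p)\<^sup>2) (at p)"
    "(gV E has_real_derivative vV E p) (at p)"
    unfolding at by auto
qed

lemma vap_admittance_pos: "0 < p \<Longrightarrow> 0 < vap_admittance p"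
  by (simp add: vap_admittance_def vapor_facts)

lemma range_pos: "p \<in> vapor_range E \<alpha> \<Longrightarrow> 0 < p"
  by (simp add: vapor_range_def)

lemma range_downward: "p \<in> vapor_range E \<alpha> \<Longrightarrow> 0 < r \<Longrightarrow> r \<le> p \<Longrightarrow> r \<in> vapor_range E \<alpha>"
  by (simp add: vapor_range_def)

lemma psat_in_range: "psat E \<in> vapor_range E \<alpha>"
proof -
  have "1 \<le> sqrt (11 - 6 * \<alpha>)" using alpha by simp
  then have "1 \<le> sigma_max \<alpha>" by (simp add: sigma_max_def)
  then show ?thesis using psat_pos by (simp add: vapor_range_def)
qed

lemma below_psat_in_range: "0 < p \<Longrightarrow> p \<le> psat E \<Longrightarrow> p \<in> vapor_range E \<alpha>"
  using range_downward[OF psat_in_range] .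

lemma volume_ratio:
  assumes "p \<in> vapor_range E \<alpha>" "pmin E \<le> q"
  shows "vL E q \<le> \<alpha> * vV E p" "vL E q < vV E p"
proof -
  have w: "0 < vV E p" using assms vapor_facts range_pos by blast
  have "vL E q / vV E p \<le> \<alpha>" using bounds assms by (auto simp: constitutive_bounds_def)
  then show le: "vL E q \<le> \<alpha> * vV E p" using w by (simp add: pos_divide_le_eq)
  also have "\<dots> < 1 * vV E p" using w alpha by (intro mult_strict_right_mono) auto
  finally show "vL E q < vV E p" by simp
qed

lemma admittance_ratio:
  assumes "p \<in> vapor_range E \<alpha>" "pmin E \<le> q"
  shows "c q \<le> \<alpha> * \<beta> * vap_admittance p"
proof -
  have w: "0 < vV E p" "0 < aV E p" using assms vapor_facts range_pos by blast+
  have b: "0 < aL E q" using liq.a_pos assms by simp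
  have "(vL E q * aV E p) / (vV E p * aL E q) \<le> \<alpha> * \<beta>"
    using bounds assms by (auto simp: constitutive_bounds_def)
  then show ?thesis using w b by (simp add: liq.admittance_def vap_admittance_def field_simps)
qed

lemma gam_vapor:
  assumes "p \<in> vapor_range E \<alpha>"
  shows "0 < gam (vapor E) p" "gam (vapor E) p \<le> 1"
proof -
  have p: "0 < p" using assms range_pos by simp
  show "0 < gam (vapor E) p" using vapor_facts[OF p] p by (simp add: gam_def)
  \<comment> \<open>The liquid pressure 1 is an arbitrary positive witness; either alternative
    bounds the vapor value.\<close>
  have "gam (vapor E) p \<le> 1 \<or> gam (vapor E) p < 1"
    using bounds assms zero_less_one unfolding constitutive_bounds_def by blast
  then show "gam (vapor E) p \<le> 1" by auto
qed

text \<open>As \<open>pmin E \<le> 0\<close>, the liquid state is regular at pressure 0, so \<open>1 / \<gamma>\<^sub>L\<close> tends to 0 there and only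
  the first alternative of the constitutive bounds can hold for small liquid pressures.\<close>

lemma eps_le:
  assumes p: "p \<in> vapor_range E \<alpha>"
  shows "eps E \<alpha> \<beta> p \<le> - \<alpha>"
proof -
  define M where "M = \<alpha> * \<beta> * vap_admittance p"
  have v1: "0 < vL E 1" using liq.v_pos pmin_le by simp
  have lim: "((\<lambda>q. q * (M\<^sup>2 / vL E 1)) \<longlongrightarrow> 0) (at_right 0)"
    using v1 by (auto intro!: tendsto_eq_intros)
  \<comment> \<open>\<open>1 / gam (liquid E) q\<close> equals \<open>q * (c q)^2 / vL E q\<close>;
    on \<open>(0, 1)\<close> the admittance is at most \<open>M\<close> and the volume at least
    \<open>vL E 1\<close>.\<close>
  have est: "1 / gam (liquid E) q \<le> q * (M\<^sup>2 / vL E 1)" if q: "0 < q" "q < 1" for q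
  proof -
    have mq: "pmin E \<le> q" using q pmin_le by simp
    have "(c q)\<^sup>2 \<le> M\<^sup>2"
      using admittance_ratio[OF p mq] liq.admittance_pos[OF mq]
      by (intro power_mono) (auto simp: M_def)
    moreover have "vL E 1 \<le> vL E q"
      using liq.v_strict_antimono[OF mq q(2)] by simp
    ultimately have "q * ((c q)\<^sup>2 / vL E q) \<le> q * (M\<^sup>2 / vL E 1)"
      using q v1 by (intro mult_left_mono frac_le) auto
    moreover have "1 / gam (liquid E) q = q * ((c q)\<^sup>2 / vL E q)"
      using liq.v_pos[OF mq] liq.a_pos[OF mq]
      by (simp add: gam_def liq.admittance_def power2_eq_square)
    ultimately show ?thesis by simp
  qed
  have "1 + eps E \<alpha> \<beta> p / \<alpha> \<le> 0"
  proof (rule tendsto_lowerbound[OF lim])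
    have "\<forall>\<^sub>F q in at_right 0. q * (M\<^sup>2 / vL E 1) < 1"
      using order_tendstoD(2)[OF lim] by simp
    moreover have "\<forall>\<^sub>F q in at_right (0::real). 0 < q \<and> q < 1"
      by (auto simp: eventually_at_right_field intro: exI[of _ 1])
    ultimately show "\<forall>\<^sub>F q in at_right 0. 1 + eps E \<alpha> \<beta> p / \<alpha> \<le> q * (M\<^sup>2 / vL E 1)"
    proof eventually_elim
      case (elim q)
      have mq: "pmin E \<le> q" using elim pmin_le by simp
      have gpos: "0 < gam (liquid E) q"
        using elim liq.v_pos[OF mq] liq.a_pos[OF mq] by (simp add: gam_def)
      have "1 / gam (liquid E) q < 1" using est[of q] elim by simp
      then have "\<not> gam (liquid E) q < 1" using gpos by (simp add: field_simps)
      then have "1 / gam (liquid E) q \<ge> 1 + eps E \<alpha> \<beta> p / \<alpha>"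
        using bounds p elim unfolding constitutive_bounds_def by blast
      with est[of q] elim show ?case by simp
    qed
  qed simp
  then show ?thesis using alpha by (simp add: field_simps)
qed

text \<open>Let \<open>k\<close> be the right-hand side. By \<open>a^2 = \<gamma> p v\<close>,
  \<open>eps\<close> equals
  \<open>(1 - \<gamma> - k * (1 - (\<alpha> * \<beta>)^2)) / \<gamma>\<close>, so
  \<open>eps \<le> - \<alpha>\<close> bounds \<open>k\<close> from below. This is the source of the
  hypothesis \<open>(1 - g) * y \<le> k\<close> in \<open>slope_inequality\<close>.\<close>

lemma kinetic_coefficient_lower:
  assumes p: "p \<in> vapor_range E \<alpha>"
  shows "1 - (1 - \<alpha>) * gam (vapor E) p \<le> (1 - \<alpha>)\<^sup>2 * (tau E * p * aV E p * vV E p)"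
proof -
  let ?g = "gam (vapor E) p" and ?k = "(1 - \<alpha>)\<^sup>2 * (tau E * p * aV E p * vV E p)"
  have pp: "0 < p" using p range_pos by simp
  note w = vapor_facts(1,2)[OF pp]
  note g = gam_vapor[OF p]
  have k: "0 \<le> ?k" using tau_pos pp w by simp
  have "?g * (p * vV E p) = (aV E p)\<^sup>2"
    using w pp by (simp add: gam_def)
  then have eq: "tau E * aV E p ^ 3 = tau E * aV E p * (?g * (p * vV E p))"
    by (simp add: power3_eq_cube power2_eq_square)
  have "tau E * aV E p ^ 3 / ?g\<^sup>2 * (1 - \<alpha>)\<^sup>2 = ?k / ?g"
    unfolding eq using g by (simp add: power2_eq_square field_simps)
  then have "eps E \<alpha> \<beta> p = (1 - ?g - ?k * (1 - (\<alpha> * \<beta>)\<^sup>2)) / ?g"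
    using g by (simp add: eps_def diff_divide_distrib)
  then have "1 - ?g - ?k * (1 - (\<alpha> * \<beta>)\<^sup>2) \<le> - \<alpha> * ?g"
    using eps_le[OF p] g by (simp only: pos_divide_le_eq)
  then have "1 - (1 - \<alpha>) * ?g \<le> ?k * (1 - (\<alpha> * \<beta>)\<^sup>2)"
    by (simp add: algebra_simps)
  also have "\<dots> \<le> ?k * 1"
    using k by (intro mult_left_mono) auto
  finally show ?thesis by simp
qed

section \<open>The interface flux and the liquid pressure\<close>

definition flux :: "real \<Rightarrow> real \<Rightarrow> real" where
  "flux p q = p * h E p q"

definition momentum_defect :: "real \<Rightarrow> real \<Rightarrow> real" where
  "momentum_defect p q = q - p + (flux p q)\<^sup>2 * (vL E q - vV E p)"

lemma interface_pressure_iff: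
  assumes "0 < p" "pmin E \<le> q"
  shows "interface_pressure E p q \<longleftrightarrow>
    momentum_defect p q = 0 \<and> - 1 \<le> flux p q * vap_admittance p \<and> flux p q * c q \<le> 1"
proof -
  note pos = vapor_facts(1,2)[OF assms(1)] liq.v_pos[OF assms(2)] liq.a_pos[OF assms(2)]
  have "- (aV E p / vV E p) \<le> z \<longleftrightarrow> - 1 \<le> z * vap_admittance p"
    "z \<le> aL E q / vL E q \<longleftrightarrow> z * c q \<le> 1" for z
    using pos by (auto simp: vap_admittance_def liq.admittance_def divide_simps mult.commute)
  with assms show ?thesis
    by (simp add: interface_pressure_def momentum_defect_def flux_def)
qed

lemma phi_interface: "p \<in> vapor_range E \<alpha> \<Longrightarrow> interface_pressure E p (phi E p)"
  unfolding phi_def by (rule theI'[OF interface_unique])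

lemma phi_eq: "p \<in> vapor_range E \<alpha> \<Longrightarrow> interface_pressure E p q \<Longrightarrow> phi E p = q"
  unfolding phi_def by (rule the1_equality[OF interface_unique])

lemma zflux_eq: "zflux E p = flux p (phi E p)"
  by (simp add: zflux_def flux_def)

lemma phi_ge:
  assumes "p \<in> vapor_range E \<alpha>"
  shows "p \<le> phi E p"
proof -
  note ip = phi_interface[OF assms]
  then have "phi E p - p = (p * h E p (phi E p))\<^sup>2 * (vV E p - vL E (phi E p))"
    by (simp add: interface_pressure_def algebra_simps)
  also have "\<dots> \<ge> 0"
    using volume_ratio(2)[OF assms, of "phi E p"] ip by (simp add: interface_pressure_def)
  finally show ?thesis by simp
qed

lemma h_deriv_liquid:
  assumes "pmin E < q"
  shows "(h E p has_real_derivative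
    tau E / 2 * ((vL E q - vV E p) + (q - p) * (c q)\<^sup>2)) (at q)"
  unfolding h_def using assms
  by (auto intro!: derivative_eq_intros liq.g_deriv liq.v_deriv simp: field_simps)

lemma h_deriv_vapor:
  assumes "0 < p"
  shows "((\<lambda>p. h E p q) has_real_derivative
    tau E / 2 * ((vL E q - vV E p) + (q - p) * (vap_admittance p)\<^sup>2)) (at p)"
  unfolding h_def using assms
  by (auto intro!: derivative_eq_intros vapor_facts simp: field_simps)

text \<open>The left side, which is the bracket in the derivative of \<open>h E p\<close>, measures
  the tangent to the liquid curve at \<open>q\<close>, evaluated at \<open>p\<close>, against
  \<open>vV E p\<close>. By convexity the tangent lies below \<open>vL E p\<close>, hence below the
  vapor volume.\<close>

lemma tangent_below_vapor:
  assumes "p \<in> vapor_range E \<alpha>" "p \<le> q"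
  shows "(vL E q - vV E p) + (q - p) * (c q)\<^sup>2 \<le> vL E p - vV E p"
    "(vL E q - vV E p) + (q - p) * (c q)\<^sup>2 < 0"
proof -
  have p: "pmin E \<le> p" using range_pos[OF assms(1)] pmin_le by simp
  show le: "(vL E q - vV E p) + (q - p) * (c q)\<^sup>2 \<le> vL E p - vV E p"
    using liq.chord_gt_right[OF p, of q] assms(2) by (cases "p = q") auto
  also have "\<dots> < 0" using volume_ratio(2)[OF assms(1) p] by simp
  finally show "(vL E q - vV E p) + (q - p) * (c q)\<^sup>2 < 0" .
qed

lemma h_strict_antimono:
  assumes "p \<in> vapor_range E \<alpha>" "p \<le> q" "q < r"
  shows "h E p r < h E p q"
proof (rule DERIV_neg_imp_decreasing[OF assms(3)])
  fix x assume x: "q \<le> x" "x \<le> r"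
  have "pmin E < x" using range_pos[OF assms(1)] pmin_le x assms by simp
  moreover have "tau E / 2 * ((vL E x - vV E p) + (x - p) * (c x)\<^sup>2) < 0"
    using tangent_below_vapor(2)[of p x] tau_pos x assms by (intro mult_pos_neg) auto
  ultimately show "\<exists>y. (h E p has_real_derivative y) (at x) \<and> y < 0"
    using h_deriv_liquid by blast
qed

text \<open>A rate of decay, which ensures that \<open>h E p\<close> reaches zero at a finite
  pressure.\<close>

lemma h_linear_bound:
  assumes "p \<in> vapor_range E \<alpha>" "p \<le> q"
  shows "h E p q \<le> h E p p - tau E / 2 * (vV E p - vL E p) * (q - p)"
proof -
  let ?D = "tau E / 2 * (vV E p - vL E p)"
  have "h E p q + ?D * q \<le> h E p p + ?D * p"
  proof (rule DERIV_nonpos_imp_nonincreasing[OF assms(2)])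
    fix x assume x: "p \<le> x" "x \<le> q"
    have "pmin E < x" using range_pos[OF assms(1)] pmin_le x assms by simp
    then have "((\<lambda>q. h E p q + ?D * q) has_real_derivative
        tau E / 2 * ((vL E x - vV E p) + (x - p) * (c x)\<^sup>2) + ?D) (at x)"
      by (auto intro!: derivative_eq_intros h_deriv_liquid)
    moreover have "tau E / 2 * ((vL E x - vV E p) + (x - p) * (c x)\<^sup>2) \<le>
        tau E / 2 * (vL E p - vV E p)"
      using tangent_below_vapor(1)[of p x] tau_pos x assms by (intro mult_left_mono) auto
    ultimately show "\<exists>y. ((\<lambda>q. h E p q + ?D * q) has_real_derivative y) (at x) \<and> y \<le> 0"
      by (intro exI conjI) (assumption, simp add: algebra_simps)
  qed
  then show ?thesis by (simp add: algebra_simps add_divide_distrib diff_divide_distrib)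
qed

lemma flux_strict_antimono:
  "p \<in> vapor_range E \<alpha> \<Longrightarrow> p \<le> q \<Longrightarrow> q < r \<Longrightarrow> flux p r < flux p q"
  using h_strict_antimono range_pos by (simp add: flux_def)

lemma flux_isCont_liquid: "pmin E < q \<Longrightarrow> isCont (flux p) q"
  unfolding flux_def using h_deriv_liquid DERIV_isCont by (intro continuous_intros) blast

lemma flux_isCont_vapor: "0 < p \<Longrightarrow> isCont (\<lambda>p. flux p q) p"
  unfolding flux_def using h_deriv_vapor DERIV_isCont by (intro continuous_intros) blast

lemma momentum_defect_isCont_liquid: "pmin E < q \<Longrightarrow> isCont (momentum_defect p) q"
  unfolding momentum_defect_def
  by (intro continuous_intros flux_isCont_liquid DERIV_isCont[OF liq.v_deriv])

lemma momentum_defect_isCont_vapor: "0 < p \<Longrightarrow> isCont (\<lambda>p. momentum_defect p q) p"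
  unfolding momentum_defect_def
  by (intro continuous_intros flux_isCont_vapor DERIV_isCont[OF vapor_facts(3)])

text \<open>On the part of \<open>q \<ge> p\<close> where the flux is nonnegative, both the flux and the flux times the
  liquid admittance decrease in \<open>q\<close>, so the side conditions only have to be checked at the ends.\<close>

lemma phi_between:
  assumes p: "p \<in> vapor_range E \<alpha>" and lo: "p \<le> lo" "lo < hi"
    and sign: "momentum_defect p lo < 0" "0 < momentum_defect p hi"
    and side: "0 \<le> flux p hi" "flux p lo * c lo \<le> 1"
  shows "lo < phi E p" "phi E p < hi" "0 < flux p (phi E p)" "flux p (phi E p) * c (phi E p) < 1"
proof -
  have pp: "0 < p" using p range_pos by simp
  have above: "pmin E < x" if "lo \<le> x" for x using that lo pp pmin_le by simp
  obtain q where q: "lo \<le> q" "q \<le> hi" "momentum_defect p q = 0"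
    using IVT[of "momentum_defect p" lo 0 hi] sign lo above momentum_defect_isCont_liquid
    by (meson less_imp_le)
  have q': "lo < q" "q < hi" using q sign by (auto simp: less_le)
  have mq: "pmin E < q" using above q by simp
  have pos: "0 < flux p q"
    using flux_strict_antimono[OF p _ q'(2)] lo q' side by simp
  have cpos: "0 < c q" using liq.admittance_pos mq by simp
  have "flux p q * c q < flux p lo * c q"
    using flux_strict_antimono[OF p lo(1) q'(1)] cpos by simp
  also have "\<dots> \<le> flux p lo * c lo"
    using flux_strict_antimono[OF p lo(1) q'(1)] pos above q
    by (intro mult_left_mono liq.admittance_antimono) (auto simp: less_imp_le)
  finally have less: "flux p q * c q < 1" using side by simp
  have "0 \<le> flux p q * vap_admittance p" using pos vap_admittance_pos[OF pp] by simp
  then have "interface_pressure E p q"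
    using interface_pressure_iff[OF pp, of q] mq q less by simp
  then have "phi E p = q" by (rule phi_eq[OF p])
  with q' pos less show "lo < phi E p" "phi E p < hi" "0 < flux p (phi E p)"
    "flux p (phi E p) * c (phi E p) < 1" by auto
qed

lemma gibbs_difference_antimono:
  assumes "q \<in> vapor_range E \<alpha>" "0 < p" "p < q"
  shows "gL E q - gV E q < gL E p - gV E p"
proof (rule DERIV_neg_imp_decreasing[OF assms(3)])
  fix x assume x: "p \<le> x" "x \<le> q"
  have xr: "x \<in> vapor_range E \<alpha>" using range_downward[OF assms(1)] x assms by simp
  have "pmin E < x" "0 < x" using x assms pmin_le by auto
  then have "((\<lambda>x. gL E x - gV E x) has_real_derivative vL E x - vV E x) (at x)"
    by (intro DERIV_diff liq.g_deriv vapor_facts)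
  moreover have "vL E x - vV E x < 0" using volume_ratio(2)[OF xr] \<open>pmin E < x\<close> by simp
  ultimately show "\<exists>y. ((\<lambda>x. gL E x - gV E x) has_real_derivative y) (at x) \<and> y < 0" by blast
qed

lemma h_diag: "h E p p = tau E * (gL E p - gV E p)"
  by (simp add: h_def)

text \<open>Below saturation the flux is positive at \<open>q = p\<close>. The upper end of the
  bracket is the pressure where the flux vanishes, so that the defect there is
  \<open>hi - p > 0\<close>; the lower end is \<open>p\<close>, or the sonic point if the flux at
  \<open>p\<close> is supersonic for the liquid.\<close>

lemma phi_evaporation:
  assumes "0 < p" "p < psat E"
  shows "p < phi E p" "0 < flux p (phi E p)" "flux p (phi E p) * c (phi E p) < 1"
proof -
  have p: "p \<in> vapor_range E \<alpha>" using assms below_psat_in_range by simp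
  have mp: "pmin E < p" using assms pmin_le by simp
  have w: "vL E p < vV E p" using volume_ratio(2)[OF p] mp by simp
  have "0 < h E p p"
    using gibbs_difference_antimono[OF psat_in_range assms] gibbs_psat tau_pos
    by (simp add: h_diag)
  then have fp: "0 < flux p p" using assms by (simp add: flux_def)
  define D where "D = tau E / 2 * (vV E p - vL E p)"
  have D: "0 < D" using w tau_pos by (simp add: D_def)
  \<comment> \<open>The zero of the linear upper bound for \<open>h E p\<close>.\<close>
  define Q where "Q = p + h E p p / D"
  have Q: "p < Q" using D \<open>0 < h E p p\<close> by (simp add: Q_def)
  have "h E p Q \<le> 0"
    using h_linear_bound[OF p less_imp_le[OF Q], folded D_def] D by (simp add: Q_def)
  then have fQ: "flux p Q \<le> 0" using assms by (simp add: flux_def mult_le_0_iff)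
  obtain hi where hi: "p \<le> hi" "flux p hi = 0"
    using IVT2[of "flux p" Q 0 p] fQ fp Q flux_isCont_liquid mp by fastforce
  then have hi': "p < hi" using fp by (auto simp: less_le)
  have Fhi: "0 < momentum_defect p hi" using hi hi' by (simp add: momentum_defect_def)
  obtain lo where lo: "p \<le> lo" "lo < hi" "momentum_defect p lo < 0" "flux p lo * c lo \<le> 1"
  proof (cases "flux p p * c p \<le> 1")
    case True
    have "momentum_defect p p < 0"
      using fp w by (simp add: momentum_defect_def mult_pos_neg)
    with True hi' that show thesis by blast
  next
    case False
    \<comment> \<open>At the sonic point \<open>flux p lo * c lo = 1\<close>, so the defect times
      \<open>(c lo)^2\<close> is exactly the tangent expression, which is negative.\<close>
    have "isCont c x" if "p \<le> x" for x
      by (rule liq.admittance_isCont) (use that mp in simp)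
    then have "\<forall>x. p \<le> x \<and> x \<le> hi \<longrightarrow> isCont (\<lambda>x. flux p x * c x) x"
      using flux_isCont_liquid mp by (intro allI impI isCont_mult) auto
    then obtain lo where lo: "p \<le> lo" "lo \<le> hi" "flux p lo * c lo = 1"
      using IVT2[of "\<lambda>x. flux p x * c x" hi 1 p] False hi by (auto simp: hi(2))
    then have "lo \<noteq> hi" using hi by auto
    have clo: "0 < c lo" using liq.admittance_pos[of lo] lo mp by simp
    have "momentum_defect p lo * (c lo)\<^sup>2 =
        (flux p lo * c lo)\<^sup>2 * (vL E lo - vV E p) + (lo - p) * (c lo)\<^sup>2"
      by (simp add: momentum_defect_def power2_eq_square algebra_simps)
    then have "momentum_defect p lo * (c lo)\<^sup>2 = (vL E lo - vV E p) + (lo - p) * (c lo)\<^sup>2"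
      by (simp add: lo(3))
    then have "momentum_defect p lo * (c lo)\<^sup>2 < 0"
      using tangent_below_vapor(2)[OF p lo(1)] by simp
    then have "momentum_defect p lo < 0" using clo by (simp add: mult_less_0_iff)
    with lo \<open>lo \<noteq> hi\<close> that show thesis by simp
  qed
  from phi_between[OF p lo(1,2,3) Fhi _ lo(4)] hi lo
  show "p < phi E p" "0 < flux p (phi E p)" "flux p (phi E p) * c (phi E p) < 1" by auto
qed

text \<open>From saturation on, the Gibbs difference and with it \<open>h E p p\<close> is
  nonpositive, and \<open>h E p\<close> only decreases from \<open>p\<close> to
  \<open>phi E p\<close>.\<close>

lemma zflux_pos_imp_below_psat:
  assumes "p \<in> vapor_range E \<alpha>" "0 < zflux E p"
  shows "p < psat E"
proof (rule ccontr)
  assume "\<not> p < psat E"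
  then have "gL E p - gV E p \<le> 0"
    using gibbs_difference_antimono[OF assms(1) psat_pos] gibbs_psat by (cases "p = psat E") auto
  then have "h E p p \<le> 0" using tau_pos by (simp add: h_diag mult_le_0_iff)
  moreover have "h E p (phi E p) \<le> h E p p"
    using h_strict_antimono[OF assms(1), of p "phi E p"] phi_ge[OF assms(1)]
    by (cases "p = phi E p") auto
  ultimately show False
    using assms range_pos[OF assms(1)] by (simp add: zflux_def zero_less_mult_iff)
qed

section \<open>Regularity of the liquid pressure\<close>

lemma flux_momentum_defect_has_derivative:
  assumes p: "0 < p" and q: "pmin E < q"
  defines "zp \<equiv> h E p q + p * (tau E / 2 * ((vL E q - vV E p) + (q - p) * (vap_admittance p)\<^sup>2))"
    and "zq \<equiv> p * (tau E / 2 * ((vL E q - vV E p) + (q - p) * (c q)\<^sup>2))"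
  shows "((\<lambda>x. flux (fst x) (snd x)) has_derivative (\<lambda>(s, t). zp * s + zq * t)) (at (p, q))"
    "((\<lambda>x. momentum_defect (fst x) (snd x)) has_derivative (\<lambda>(s, t).
      (- 1 + 2 * flux p q * zp * (vL E q - vV E p) + (flux p q)\<^sup>2 * (vap_admittance p)\<^sup>2) * s +
      (1 + 2 * flux p q * zq * (vL E q - vV E p) - (flux p q)\<^sup>2 * (c q)\<^sup>2) * t)) (at (p, q))"
proof -
  have vL: "((\<lambda>x. vL E (snd x)) has_derivative (\<lambda>x. snd x * - (c q)\<^sup>2)) (at (p, q))"
    using liq.v_deriv[OF q] by (intro DERIV_compose_FDERIV[where g = snd and g' = snd])
      (auto intro!: derivative_eq_intros)
  have gL: "((\<lambda>x. gL E (snd x)) has_derivative (\<lambda>x. snd x * vL E q)) (at (p, q))"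
    using liq.g_deriv[OF q] by (intro DERIV_compose_FDERIV[where g = snd and g' = snd])
      (auto intro!: derivative_eq_intros)
  have vV: "((\<lambda>x. vV E (fst x)) has_derivative (\<lambda>x. fst x * - (vap_admittance p)\<^sup>2)) (at (p, q))"
    using vapor_facts(3)[OF p] by (intro DERIV_compose_FDERIV[where g = fst and g' = fst])
      (auto intro!: derivative_eq_intros)
  have gV: "((\<lambda>x. gV E (fst x)) has_derivative (\<lambda>x. fst x * vV E p)) (at (p, q))"
    using vapor_facts(4)[OF p] by (intro DERIV_compose_FDERIV[where g = fst and g' = fst])
      (auto intro!: derivative_eq_intros)
  show fl: "((\<lambda>x. flux (fst x) (snd x)) has_derivative (\<lambda>(s, t). zp * s + zq * t)) (at (p, q))"
    unfolding flux_def h_def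
    by (rule derivative_eq_intros gL gV vL vV refl)+
      (auto simp: fun_eq_iff zp_def zq_def h_def algebra_simps add_divide_distrib diff_divide_distrib)
  show "((\<lambda>x. momentum_defect (fst x) (snd x)) has_derivative (\<lambda>(s, t).
      (- 1 + 2 * flux p q * zp * (vL E q - vV E p) + (flux p q)\<^sup>2 * (vap_admittance p)\<^sup>2) * s +
      (1 + 2 * flux p q * zq * (vL E q - vV E p) - (flux p q)\<^sup>2 * (c q)\<^sup>2) * t)) (at (p, q))"
    unfolding momentum_defect_def
    by (rule derivative_eq_intros fl gL gV vL vV refl)+
      (auto simp: fun_eq_iff algebra_simps power2_eq_square)
qed

text \<open>Eliminating \<open>q - p\<close> by the momentum equation makes the partial derivative
  of the defect in \<open>q\<close> factor as \<open>(1 - x^2) * (1 + k)\<close>; subsonic liquid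
  flow and positive flux make both factors positive.\<close>

lemma phi_facts:
  assumes "0 < p" "p < psat E"
  defines "q \<equiv> phi E p"
  shows "0 < vV E p - vL E q" "q - p = (flux p q)\<^sup>2 * (vV E p - vL E q)"
    "1 + 2 * flux p q * (p * (tau E / 2 * ((vL E q - vV E p) + (q - p) * (c q)\<^sup>2))) *
        (vL E q - vV E p) - (flux p q)\<^sup>2 * (c q)\<^sup>2 =
      (1 - (flux p q * c q)\<^sup>2) * (1 + flux p q * p * tau E * (vV E p - vL E q)\<^sup>2)"
    "0 < (1 - (flux p q * c q)\<^sup>2) * (1 + flux p q * p * tau E * (vV E p - vL E q)\<^sup>2)"
proof -
  have p: "p \<in> vapor_range E \<alpha>" using assms below_psat_in_range by simp
  note ev = phi_evaporation[OF assms(1,2), folded q_def]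
  have mq: "pmin E \<le> q" using ev assms pmin_le by simp
  show "0 < vV E p - vL E q" using volume_ratio(2)[OF p mq] by simp
  show qp: "q - p = (flux p q)\<^sup>2 * (vV E p - vL E q)"
    using phi_interface[OF p] interface_pressure_iff[OF assms(1) mq]
    by (simp add: q_def momentum_defect_def algebra_simps)
  show "1 + 2 * flux p q * (p * (tau E / 2 * ((vL E q - vV E p) + (q - p) * (c q)\<^sup>2))) *
        (vL E q - vV E p) - (flux p q)\<^sup>2 * (c q)\<^sup>2 =
      (1 - (flux p q * c q)\<^sup>2) * (1 + flux p q * p * tau E * (vV E p - vL E q)\<^sup>2)"
    unfolding qp by (simp add: power2_eq_square algebra_simps)
  have "0 < flux p q * c q" using ev liq.admittance_pos[OF mq] by simp
  then have "(flux p q * c q)\<^sup>2 < 1" using ev by (simp add: power_less_one_iff abs_square_less_1)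
  moreover have "0 \<le> flux p q * p * tau E * (vV E p - vL E q)\<^sup>2"
    using ev tau_pos assms by simp
  ultimately show "0 < (1 - (flux p q * c q)\<^sup>2) * (1 + flux p q * p * tau E * (vV E p - vL E q)\<^sup>2)"
    by (intro mult_pos_pos) auto
qed

lemma momentum_defect_deriv_pos:
  assumes "0 < p" "p < psat E"
  obtains D where "(momentum_defect p has_real_derivative D) (at (phi E p))" "0 < D"
proof -
  define q where "q = phi E p"
  note ev = phi_evaporation[OF assms, folded q_def]
  have mq: "pmin E < q" using ev assms pmin_le by simp
  have "((\<lambda>q. flux p q) has_real_derivative
      p * (tau E / 2 * ((vL E q - vV E p) + (q - p) * (c q)\<^sup>2))) (at q)"
    unfolding flux_def using h_deriv_liquid[OF mq] by (rule DERIV_cmult)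
  then have "(momentum_defect p has_real_derivative
      1 + 2 * flux p q * (p * (tau E / 2 * ((vL E q - vV E p) + (q - p) * (c q)\<^sup>2))) *
        (vL E q - vV E p) - (flux p q)\<^sup>2 * (c q)\<^sup>2) (at q)"
    unfolding momentum_defect_def
    by (auto intro!: derivative_eq_intros liq.v_deriv mq simp: algebra_simps)
  with that show thesis
    using phi_facts(3,4)[OF assms] by (simp add: q_def)
qed

text \<open>The defect crosses zero upwards at \<open>q\<close>, so arbitrarily close to
  \<open>q\<close> there are \<open>lo\<close> and \<open>hi\<close> satisfying the hypotheses of
  \<open>phi_between\<close> strictly. For fixed \<open>lo\<close> and \<open>hi\<close> these
  inequalities persist for \<open>r\<close> near \<open>p\<close> and trap
  \<open>phi E r\<close>.\<close>

lemma phi_isCont: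
  assumes "0 < p" "p < psat E"
  shows "isCont (phi E) p"
proof -
  have p: "p \<in> vapor_range E \<alpha>" using assms below_psat_in_range by simp
  define q where "q = phi E p"
  note ev = phi_evaporation[OF assms, folded q_def]
  have mq: "pmin E < q" using ev assms pmin_le by simp
  have F0: "momentum_defect p q = 0"
    using phi_interface[OF p] interface_pressure_iff[OF assms(1)] mq by (simp add: q_def)
  obtain D where D: "(momentum_defect p has_real_derivative D) (at q)" "0 < D"
    using momentum_defect_deriv_pos[OF assms] unfolding q_def .
  have left: "\<forall>\<^sub>F x in at_left q. momentum_defect p x < 0"
  proof -
    obtain r where r: "0 < r" "\<And>t. 0 < t \<Longrightarrow> t < r \<Longrightarrow> momentum_defect p (q - t) < 0"
      using DERIV_pos_inc_left[OF D] F0 by auto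
    have "momentum_defect p x < 0" if "q - r < x" "x < q" for x
      using r(2)[of "q - x"] that by simp
    then show ?thesis
      unfolding eventually_at_left_field using r(1) by (intro exI[of _ "q - r"]) simp
  qed
  have right: "\<forall>\<^sub>F x in at_right q. 0 < momentum_defect p x"
  proof -
    obtain r where r: "0 < r" "\<And>t. 0 < t \<Longrightarrow> t < r \<Longrightarrow> 0 < momentum_defect p (q + t)"
      using DERIV_pos_inc_right[OF D] F0 by auto
    have "0 < momentum_defect p x" if "q < x" "x < q + r" for x
      using r(2)[of "x - q"] that by simp
    then show ?thesis
      unfolding eventually_at_right_field using r(1) by (intro exI[of _ "q + r"]) simp
  qed
  have fl: "(flux p \<longlongrightarrow> flux p q) (at q)"
    using flux_isCont_liquid[OF mq] by (simp add: isCont_def)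
  have cl: "(c \<longlongrightarrow> c q) (at q)"
    using liq.admittance_isCont[OF mq] by (simp add: isCont_def)
  show ?thesis
    unfolding isCont_def
  proof (rule tendstoI)
    fix e :: real assume e: "0 < e"
    have "\<forall>\<^sub>F x in at_left q. flux p x * c x < 1"
      using order_tendstoD(2)[OF tendsto_mult[OF fl cl] ev(3)] filterlim_at_split
      by (simp add: eventually_at_split)
    moreover have "\<forall>\<^sub>F x in at_left q. max p (q - e) < x \<and> x < q"
      using ev e by (auto simp: eventually_at_left_field intro!: exI[of _ "max p (q - e)"])
    ultimately have "\<forall>\<^sub>F x in at_left q. momentum_defect p x < 0 \<and> flux p x * c x < 1 \<and>
        max p (q - e) < x \<and> x < q"
      using left by eventually_elim auto
    then obtain lo where lo: "momentum_defect p lo < 0" "flux p lo * c lo < 1"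
        "p < lo" "q - e < lo" "lo < q"
      using eventually_happens'[OF trivial_limit_at_left_real] by auto
    have "\<forall>\<^sub>F x in at_right q. 0 < flux p x"
      using order_tendstoD(1)[OF fl ev(2)] by (simp add: eventually_at_split)
    moreover have "\<forall>\<^sub>F x in at_right q. q < x \<and> x < q + e"
      using e by (auto simp: eventually_at_right_field intro!: exI[of _ "q + e"])
    ultimately have "\<forall>\<^sub>F x in at_right q. 0 < momentum_defect p x \<and> 0 < flux p x \<and> q < x \<and> x < q + e"
      using right by eventually_elim auto
    then obtain hi where hi: "0 < momentum_defect p hi" "0 < flux p hi" "q < hi" "hi < q + e"
      using eventually_happens'[OF trivial_limit_at_right_real] by auto
    have fluxp: "((\<lambda>p. flux p x) \<longlongrightarrow> flux p x) (at p)"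
      and defect: "((\<lambda>p. momentum_defect p x) \<longlongrightarrow> momentum_defect p x) (at p)" for x
      using flux_isCont_vapor[OF assms(1)] momentum_defect_isCont_vapor[OF assms(1)]
      by (auto simp: isCont_def)
    have "\<forall>\<^sub>F r in at p. momentum_defect r lo < 0" "\<forall>\<^sub>F r in at p. 0 < momentum_defect r hi"
      "\<forall>\<^sub>F r in at p. 0 < flux r hi" "\<forall>\<^sub>F r in at p. flux r lo * c lo < 1"
      "\<forall>\<^sub>F r in at p. 0 < r" "\<forall>\<^sub>F r in at p. r < psat E" "\<forall>\<^sub>F r in at p. r < lo"
      using order_tendstoD(2)[OF defect lo(1)] order_tendstoD(1)[OF defect hi(1)]
        order_tendstoD(1)[OF fluxp hi(2)]
        order_tendstoD(2)[OF tendsto_mult_right[OF fluxp] lo(2)]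
        order_tendstoD[OF tendsto_ident_at] assms lo(3) by auto
    then show "\<forall>\<^sub>F r in at p. dist (phi E r) (phi E p) < e"
    proof eventually_elim
      case (elim r)
      then have "lo < phi E r" "phi E r < hi"
        using phi_between[of r lo hi] below_psat_in_range[of r] lo hi by auto
      then show ?case
        using lo hi by (simp add: q_def dist_real_def abs_less_iff)
    qed
  qed
qed

lemma phi_deriv:
  assumes "0 < p" "p < psat E"
  defines "q \<equiv> phi E p"
  defines "x \<equiv> flux p q * c q" and "y \<equiv> flux p q * vap_admittance p"
    and "k \<equiv> flux p q * p * tau E * (vV E p - vL E q)\<^sup>2"
    and "G \<equiv> gam (vapor E) p * ((vV E p - vL E q) / vV E p)"
  shows "(phi E has_real_derivative
      ((1 - y\<^sup>2) * (1 - k) + 2 * y\<^sup>2 * G) / ((1 - x\<^sup>2) * (1 + k))) (at p)"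
proof -
  note ev = phi_evaporation[OF assms(1,2), folded q_def]
  note facts = phi_facts[OF assms(1,2), folded q_def]
  note w = vapor_facts(1,2)[OF assms(1)]
  have mq: "pmin E < q" using ev assms pmin_le by simp
  define zp where "zp = h E p q + p * (tau E / 2 * ((vL E q - vV E p) + (q - p) * (vap_admittance p)\<^sup>2))"
  define zq where "zq = p * (tau E / 2 * ((vL E q - vV E p) + (q - p) * (c q)\<^sup>2))"
  define A where "A = - 1 + 2 * flux p q * zp * (vL E q - vV E p) + (flux p q)\<^sup>2 * (vap_admittance p)\<^sup>2"
  define B where "B = 1 + 2 * flux p q * zq * (vL E q - vV E p) - (flux p q)\<^sup>2 * (c q)\<^sup>2"
  have B: "B = (1 - x\<^sup>2) * (1 + k)" "0 < B"
    using facts(3,4) by (auto simp: B_def zq_def x_def k_def)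
  have zero: "\<forall>\<^sub>F r in nhds p. momentum_defect (fst (r, phi E r)) (snd (r, phi E r)) = 0"
  proof -
    have "\<forall>\<^sub>F r in nhds p. r \<in> {0<..<psat E}"
      using assms by (intro eventually_nhds_in_open) auto
    then show ?thesis
    proof eventually_elim
      case (elim r)
      then have r: "r \<in> vapor_range E \<alpha>" "0 < r" using below_psat_in_range by auto
      with phi_interface[OF r(1)] interface_pressure_iff[OF r(2)] show ?case
        by (auto simp: interface_pressure_def)
    qed
  qed
  have "(phi E has_real_derivative - A / B) (at p)"
    by (rule implicit_function_deriv[OF _ _ phi_isCont[OF assms(1,2)] zero])
      (use flux_momentum_defect_has_derivative(2)[OF assms(1) mq] B(2)
       in \<open>simp_all add: A_def B_def zp_def zq_def q_def\<close>)
  moreover have "- A = (1 - y\<^sup>2) * (1 - k) + 2 * y\<^sup>2 * G"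
  proof -
    \<comment> \<open>The part of the \<open>p\<close>-derivative that comes from the prefactor
      \<open>p\<close> of the flux produces \<open>G\<close>, through
      \<open>z * h = z^2 / p\<close>; the rest collapses to \<open>k * (1 - y^2)\<close> by the
      momentum equation.\<close>
    have "y\<^sup>2 * G = (flux p q)\<^sup>2 * (vV E p - vL E q) / p"
      using w assms(1) by (simp add: y_def G_def gam_def vap_admittance_def power2_eq_square field_simps)
    moreover have zh: "flux p q * h E p q = (flux p q)\<^sup>2 / p"
      using assms(1) by (simp add: flux_def power2_eq_square)
    have "2 * flux p q * h E p q * (vL E q - vV E p) =
        - 2 * ((flux p q * h E p q) * (vV E p - vL E q))"
      by (simp add: algebra_simps)
    ultimately have T1: "2 * flux p q * h E p q * (vL E q - vV E p) = - 2 * (y\<^sup>2 * G)"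
      by (simp add: zh)
    have T2: "2 * flux p q * (p * (tau E / 2 * ((vL E q - vV E p) + (q - p) * (vap_admittance p)\<^sup>2))) *
        (vL E q - vV E p) = k * (1 - y\<^sup>2)"
      unfolding facts(2) k_def y_def by (simp add: power2_eq_square algebra_simps)
    have "A = - 1 + 2 * flux p q * h E p q * (vL E q - vV E p) +
        2 * flux p q * (p * (tau E / 2 * ((vL E q - vV E p) + (q - p) * (vap_admittance p)\<^sup>2))) *
        (vL E q - vV E p) + y\<^sup>2"
      by (simp add: A_def zp_def y_def power_mult_distrib algebra_simps)
    then show ?thesis unfolding T1 T2 by (simp add: algebra_simps)
  qed
  ultimately show ?thesis by (simp add: B)
qed

section \<open>Monotonicity of \<open>f_z\<close>\<close>

lemma wave_fun_eq:
  assumes "pmin E \<le> p" "pmin E \<le> q"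
  shows "wave_fun E p q = liq.wave p q"
proof (cases "p < q")
  case True
  then show ?thesis by (simp add: wave_fun_def liq.wave_def algebra_simps)
next
  case False
  have "integral {q..p} (\<lambda>\<zeta>. vL E \<zeta> / aL E \<zeta>) = integral {q..p} c"
    by (simp add: liq.admittance_def[abs_def])
  with False assms liq.riemann_diff[of q p] show ?thesis
    by (simp add: wave_fun_def liq.wave_def)
qed

lemma f_z_deriv_pos:
  assumes p: "0 < p" "p < psat E" and W: "pmin E \<le> fst Wm" "pmin E \<le> fst Wp"
  obtains D where "((\<lambda>p. f_z E p Wm Wp) has_real_derivative D) (at p)" "0 < D"
proof -
  define q where "q = phi E p"
  define z where "z = flux p q"
  define x y k G where "x = z * c q" and "y = z * vap_admittance p"
    and "k = z * p * tau E * (vV E p - vL E q)\<^sup>2"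
    and "G = gam (vapor E) p * ((vV E p - vL E q) / vV E p)"
  define \<phi>' where "\<phi>' = ((1 - y\<^sup>2) * (1 - k) + 2 * y\<^sup>2 * G) / ((1 - x\<^sup>2) * (1 + k))"
  have pr: "p \<in> vapor_range E \<alpha>" using p below_psat_in_range by simp
  note ev = phi_evaporation[OF p, folded q_def, folded z_def]
  note facts = phi_facts[OF p, folded q_def, folded z_def]
  note w = vapor_facts(1,2)[OF p(1)]
  have mq: "pmin E < q" using ev p pmin_le by simp
  have v: "0 < vL E q" and cq: "0 < c q" using liq.v_pos liq.admittance_pos mq by auto
  have \<phi>': "(phi E has_real_derivative \<phi>') (at p)"
    using phi_deriv[OF p] by (simp add: \<phi>'_def q_def z_def x_def y_def k_def G_def)
  \<comment> \<open>\<open>\<alpha> * \<beta> * vap_admittance p\<close> dominates every liquid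
    admittance, so it can serve as the uniform bound on the wave slopes.\<close>
  obtain c1 where c1: "(liq.wave (fst Wm) has_real_derivative c1) (at q)" "c q \<le> c1"
      "c1 \<le> \<alpha> * \<beta> * vap_admittance p"
    using liq.wave_deriv[OF W(1) mq, of "\<alpha> * \<beta> * vap_admittance p"] admittance_ratio[OF pr] by blast
  obtain c2 where c2: "(liq.wave (fst Wp) has_real_derivative c2) (at q)" "c q \<le> c2"
      "c2 \<le> \<alpha> * \<beta> * vap_admittance p"
    using liq.wave_deriv[OF W(2) mq, of "\<alpha> * \<beta> * vap_admittance p"] admittance_ratio[OF pr] by blast
  define zp where "zp = h E p q + p * (tau E / 2 * ((vL E q - vV E p) + (q - p) * (vap_admittance p)\<^sup>2))"
  define zq where "zq = p * (tau E / 2 * ((vL E q - vV E p) + (q - p) * (c q)\<^sup>2))"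
  have dz: "((\<lambda>p. flux p (phi E p)) has_real_derivative zp + zq * \<phi>') (at p)"
    using DERIV_along_graph[OF _ \<phi>', of "\<lambda>x. flux (fst x) (snd x)" zp zq]
      flux_momentum_defect_has_derivative(1)[OF p(1) mq]
    by (simp add: zp_def zq_def q_def)
  have dF: "((\<lambda>p. momentum_defect p (phi E p)) has_real_derivative
      (- 1 + 2 * z * zp * (vL E q - vV E p) + z\<^sup>2 * (vap_admittance p)\<^sup>2) +
      (1 + 2 * z * zq * (vL E q - vV E p) - z\<^sup>2 * (c q)\<^sup>2) * \<phi>') (at p)"
    using DERIV_along_graph[OF _ \<phi>', of "\<lambda>x. momentum_defect (fst x) (snd x)"
        "- 1 + 2 * z * zp * (vL E q - vV E p) + z\<^sup>2 * (vap_admittance p)\<^sup>2"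
        "1 + 2 * z * zq * (vL E q - vV E p) - z\<^sup>2 * (c q)\<^sup>2"]
      flux_momentum_defect_has_derivative(2)[OF p(1) mq]
    by (simp add: zp_def zq_def q_def z_def)
  have near: "r \<in> vapor_range E \<alpha>" "pmin E \<le> phi E r" "momentum_defect r (phi E r) = 0"
    if "r \<in> {0<..<psat E}" for r
    using that below_psat_in_range[of r] phi_interface[of r] interface_pressure_iff[of r "phi E r"]
    by (auto simp: interface_pressure_def)
  \<comment> \<open>The interface equation holds identically near \<open>p\<close>, so its total
    derivative vanishes. This eliminates the derivative \<open>zp + zq * \<phi>'\<close> of the flux
    from \<open>z * D\<close>.\<close>
  have zero: "(- 1 + 2 * z * zp * (vL E q - vV E p) + z\<^sup>2 * (vap_admittance p)\<^sup>2) +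
      (1 + 2 * z * zq * (vL E q - vV E p) - z\<^sup>2 * (c q)\<^sup>2) * \<phi>' = 0"
  proof (rule DERIV_unique[OF dF])
    show "((\<lambda>p. momentum_defect p (phi E p)) has_real_derivative 0) (at p)"
      by (rule has_field_derivative_transform_within_open[of "\<lambda>_. 0" _ _ "{0<..<psat E}"])
        (use near p in auto)
  qed
  define D where "D = (c1 + c2) * \<phi>' + 2 * ((zp + zq * \<phi>') * (vL E q - vV E p) +
      z * (- (c q)\<^sup>2 * \<phi>' + (vap_admittance p)\<^sup>2))"
  have "((\<lambda>p. liq.wave (fst Wm) (phi E p) + liq.wave (fst Wp) (phi E p) +
      2 * flux p (phi E p) * (vL E (phi E p) - vV E p) + (snd Wp - snd Wm))
      has_real_derivative D) (at p)"
  proof -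
    note 1 = DERIV_chain2[OF c1(1)[unfolded q_def] \<phi>']
    note 2 = DERIV_chain2[OF c2(1)[unfolded q_def] \<phi>']
    note 3 = DERIV_chain2[OF liq.v_deriv[OF mq, unfolded q_def] \<phi>']
    show ?thesis
      by (rule derivative_eq_intros 1 2 3 dz vapor_facts(3)[OF p(1)] refl)+
        (simp add: D_def q_def[symmetric] z_def[symmetric] algebra_simps)
  qed
  then have deriv: "((\<lambda>p. f_z E p Wm Wp) has_real_derivative D) (at p)"
  proof (rule has_field_derivative_transform_within_open[of _ _ _ "{0<..<psat E}"])
    fix r assume "r \<in> {0<..<psat E}"
    from near(2)[OF this] W show "liq.wave (fst Wm) (phi E r) + liq.wave (fst Wp) (phi E r) +
        2 * flux r (phi E r) * (vL E (phi E r) - vV E r) + (snd Wp - snd Wm) = f_z E r Wm Wp"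
      by (simp add: f_z_def f_side_def wave_fun_eq zflux_eq)
  qed (use p in auto)
  have "0 < (z * c1 + z * c2) * \<phi>' + (1 + y\<^sup>2 - (1 + x\<^sup>2) * \<phi>')"
  proof (rule slope_inequality)
    let ?g = "(1 - \<alpha>) * gam (vapor E) p"
    note gam = gam_vapor[OF pr]
    have vw: "vL E q \<le> \<alpha> * vV E p" using volume_ratio(1)[OF pr] mq by simp
    show "0 < x" "x < 1" "0 < y" using ev cq vap_admittance_pos[OF p(1)] by (auto simp: x_def y_def)
    have "c q \<le> \<alpha> * \<beta> * vap_admittance p" using admittance_ratio[OF pr] mq by simp
    also have "\<dots> \<le> 1 * vap_admittance p" using beta vap_admittance_pos[OF p(1)] by (intro mult_right_mono) auto
    finally show "x \<le> y" using ev by (simp add: x_def y_def)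
    show "\<alpha> * \<beta> < 1" by (rule beta)
    show "0 < ?g" using gam alpha by simp
    have ratio: "1 - \<alpha> \<le> (vV E p - vL E q) / vV E p" "(vV E p - vL E q) / vV E p \<le> 1"
      using vw w v by (auto simp: field_simps)
    then show "?g \<le> G" using mult_left_mono[OF ratio(1), of "gam (vapor E) p"] gam
      by (simp add: G_def mult.commute)
    show "G \<le> 1" unfolding G_def using ratio gam alpha by (intro mult_le_one) linarith+
    show "0 < k" using ev p tau_pos facts(1) by (simp add: k_def)
    \<comment> \<open>The bound on the kinetic coefficient involves
      \<open>(1 - \<alpha>) * vV E p\<close>, which the volume ratio bounds by
      \<open>vV E p - vL E q\<close>.\<close>
    have "(1 - ?g) * y \<le> (1 - \<alpha>)\<^sup>2 * (tau E * p * aV E p * vV E p) * y"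
      using kinetic_coefficient_lower[OF pr] \<open>0 < y\<close> by (intro mult_right_mono) auto
    also have "\<dots> = z * p * tau E * ((1 - \<alpha>) * vV E p)\<^sup>2"
      using w by (simp add: y_def vap_admittance_def power2_eq_square)
    also have "\<dots> \<le> k"
      unfolding k_def using vw alpha w ev p tau_pos
      by (intro mult_left_mono power_mono) (auto simp: algebra_simps)
    finally show "(1 - ?g) * y \<le> k" .
    show "\<phi>' = ((1 - y\<^sup>2) * (1 - k) + 2 * y\<^sup>2 * G) / ((1 - x\<^sup>2) * (1 + k))"
      by (rule \<phi>'_def)
    show "x \<le> z * c1" "x \<le> z * c2" using c1 c2 ev by (auto simp: x_def)
    show "z * c1 \<le> \<alpha> * \<beta> * y" "z * c2 \<le> \<alpha> * \<beta> * y"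
      using mult_left_mono[OF c1(3), of z] mult_left_mono[OF c2(3), of z] ev
      by (auto simp: y_def mult_ac)
  qed
  also have "\<dots> = z * D"
  proof -
    have "z * D = (z * c1 + z * c2) * \<phi>' + (1 + y\<^sup>2 - (1 + x\<^sup>2) * \<phi>') +
        ((- 1 + 2 * z * zp * (vL E q - vV E p) + z\<^sup>2 * (vap_admittance p)\<^sup>2) +
      (1 + 2 * z * zq * (vL E q - vV E p) - z\<^sup>2 * (c q)\<^sup>2) * \<phi>')"
      by (simp add: D_def x_def y_def power2_eq_square algebra_simps)
    then show ?thesis unfolding zero by simp
  qed
  finally have "0 < D" using ev by (simp add: zero_less_mult_iff)
  with deriv that show thesis by blast
qed

section \<open>The Riemann problem\<close>

text \<open>The function is continuous on a half-line and tends to infinity, so having no zero there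
  means being positive.\<close>

lemma cav_fun_pos:
  assumes cav: "cavitation_criterion E Wm Wp"
    and W: "pmin E \<le> fst Wm" "pmin E \<le> fst Wp" and q: "pmin E \<le> q"
  shows "0 < cav_fun E Wm Wp q"
proof (rule ccontr)
  let ?F = "\<lambda>q. liq.wave (fst Wm) q + liq.wave (fst Wp) q + (snd Wp - snd Wm)"
  have F: "cav_fun E Wm Wp r = ?F r" if "pmin E \<le> r" for r
    using that W by (simp add: cav_fun_def wave_fun_eq)
  assume "\<not> 0 < cav_fun E Wm Wp q"
  then have "?F q \<le> 0" using F q by simp
  moreover
  have "filterlim (\<lambda>q. (snd Wp - snd Wm) + (liq.wave (fst Wm) q + liq.wave (fst Wp) q)) at_top at_top"
    by (intro filterlim_tendsto_add_at_top[OF tendsto_const] filterlim_at_top_add_at_top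
        liq.wave_at_top W)
  then have "\<forall>\<^sub>F r in at_top. 0 \<le> ?F r"
    by (simp add: filterlim_at_top add.commute)
  then obtain Q where "q \<le> Q" "0 \<le> ?F Q"
    using eventually_happens[OF eventually_conj[OF eventually_ge_at_top[of q]]] by fastforce
  moreover have "continuous_on {q..Q} ?F"
    by (intro continuous_intros continuous_on_subset[OF liq.wave_continuous] W) (use q in auto)
  ultimately obtain r where "q \<le> r" "?F r = 0"
    using IVT'[of ?F q 0 Q] by auto
  then have "pmin E \<le> r \<and> cav_fun E Wm Wp r = 0" using F q by simp
  with cav show False unfolding cavitation_criterion_def by blast
qed

lemma f_z_eq:
  "f_z E p Wm Wp = cav_fun E Wm Wp (phi E p) - 2 * zflux E p * (vV E p - vL E (phi E p))"
  by (simp add: f_z_def f_side_def cav_fun_def algebra_simps)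

lemma root_below_psat:
  assumes cav: "cavitation_criterion E Wm Wp"
    and W: "pmin E \<le> fst Wm" "pmin E \<le> fst Wp"
    and p: "p \<in> vapor_range E \<alpha>" and root: "f_z E p Wm Wp = 0"
  shows "p < psat E"
proof (rule zflux_pos_imp_below_psat[OF p])
  have q: "pmin E \<le> phi E p"
    using phi_interface[OF p] by (simp add: interface_pressure_def)
  have "0 < zflux E p * (vV E p - vL E (phi E p))"
    using cav_fun_pos[OF cav W q] root by (simp add: f_z_eq)
  then show "0 < zflux E p"
    using volume_ratio(2)[OF p q] by (simp add: zero_less_mult_iff)
qed

text \<open>Positivity of the derivative is known only below saturation, but the larger of two roots
  lies there, and so does the whole interval between them.\<close>

lemma root_unique:
  assumes cav: "cavitation_criterion E Wm Wp"
    and W: "pmin E \<le> fst Wm" "pmin E \<le> fst Wp"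
    and "p \<in> vapor_range E \<alpha>" "f_z E p Wm Wp = 0" "r \<in> vapor_range E \<alpha>" "f_z E r Wm Wp = 0"
  shows "p = r"
proof -
  have "\<not> p < r" if p: "p \<in> vapor_range E \<alpha>" "f_z E p Wm Wp = 0"
    and r: "r \<in> vapor_range E \<alpha>" "f_z E r Wm Wp = 0" for p r
  proof
    assume "p < r"
    have "f_z E p Wm Wp < f_z E r Wm Wp"
    proof (rule DERIV_pos_imp_increasing[OF \<open>p < r\<close>])
      fix x assume "p \<le> x" "x \<le> r"
      then have x: "0 < x" "x < psat E"
        using range_pos[OF p(1)] root_below_psat[OF cav W r] by auto
      obtain D where "((\<lambda>p. f_z E p Wm Wp) has_real_derivative D) (at x)" "0 < D"
        using f_z_deriv_pos[OF x W] .
      then show "\<exists>y. ((\<lambda>p. f_z E p Wm Wp) has_real_derivative y) (at x) \<and> 0 < y"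
        by blast
    qed
    with p r show False by simp
  qed
  from this[OF assms(4-7)] this[OF assms(6,7,4,5)] show ?thesis by simp
qed

section \<open>Phase boundaries\<close>

lemma boundary_VL_states:
  assumes b: "boundary_VL E (p, uV) (q, u) W" and p: "0 < p" and q: "pmin E \<le> q"
  shows "interface_pressure E p q" "W = uV + flux p q * vV E p"
    "u = uV + flux p q * (vV E p - vL E q)"
proof -
  define Z where "Z = kinetic_flux E (p, uV) (q, u) W"
  have w: "0 < vV E p" and v: "0 < vL E q" using vapor_facts(1)[OF p] liq.v_pos[OF q] .
  have Zs: "mass_flux (vapor E) (p, uV) W = Z" "mass_flux (liquid E) (q, u) W = Z"
    and mom: "- Z * (u - uV) + (q - p) = 0"
    and adm: "- (aV E p / vV E p) \<le> Z" "Z \<le> aL E q / vL E q"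
    using b by (auto simp: boundary_VL_def discontinuity_def Let_def admissible_flux_def Z_def)
  have rel: "uV - W = - (Z * vV E p)" "u - W = - (Z * vL E q)"
    using Zs w v by (auto simp: mass_flux_def field_simps)
  have du: "u - uV = Z * (vV E p - vL E q)" using rel by (simp add: algebra_simps)
  have qp: "q - p = Z\<^sup>2 * (vV E p - vL E q)"
    using mom unfolding du by (simp add: power2_eq_square)
  \<comment> \<open>The relative velocities are \<open>- Z v\<close>, so the kinetic energies differ
    by \<open>Z^2 / 2\<close> times a difference of squared volumes; with the momentum equation this
    is the trapezoid term of \<open>h\<close>.\<close>
  have tg: "total_gibbs (liquid E) (q, u) W - total_gibbs (vapor E) (p, uV) W =
      gL E q - gV E p - 1 / 2 * (Z\<^sup>2 * (vV E p - vL E q)) * (vL E q + vV E p)"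
    unfolding total_gibbs_def fst_conv snd_conv rel by (simp add: power2_eq_square field_simps)
  have "Z = tau E * p * (total_gibbs (liquid E) (q, u) W - total_gibbs (vapor E) (p, uV) W)"
    by (simp add: Z_def kinetic_flux_def)
  then have Zeq: "Z = flux p q"
    unfolding tg qp[symmetric] flux_def h_def by (simp only: mult_ac)
  show "interface_pressure E p q"
    using adm q qp by (simp add: interface_pressure_def Zeq flux_def algebra_simps)
  show "W = uV + flux p q * vV E p" using rel Zeq by simp
  show "u = uV + flux p q * (vV E p - vL E q)" using du Zeq by simp
qed

lemma boundary_VL_exists:
  assumes ip: "interface_pressure E p q" and p: "0 < p"
  shows "boundary_VL E (p, uV) (q, uV + flux p q * (vV E p - vL E q)) (uV + flux p q * vV E p)"
proof -
  define Z where "Z = flux p q"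
  define u W where "u = uV + Z * (vV E p - vL E q)" and "W = uV + Z * vV E p"
  have q: "pmin E \<le> q" using ip by (simp add: interface_pressure_def)
  have w: "0 < vV E p" and v: "0 < vL E q" using vapor_facts(1)[OF p] liq.v_pos[OF q] .
  have qp: "q - p = Z\<^sup>2 * (vV E p - vL E q)"
    using ip by (simp add: interface_pressure_def Z_def flux_def algebra_simps)
  have rel: "uV - W = - (Z * vV E p)" "u - W = - (Z * vL E q)"
    by (auto simp: u_def W_def algebra_simps)
  have Zs: "mass_flux (vapor E) (p, uV) W = Z" "mass_flux (liquid E) (q, u) W = Z"
    unfolding mass_flux_def fst_conv snd_conv rel using w v by auto
  have tg: "tau E * p * (total_gibbs (liquid E) (q, u) W - total_gibbs (vapor E) (p, uV) W) = Z"
  proof -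
    have "total_gibbs (liquid E) (q, u) W - total_gibbs (vapor E) (p, uV) W =
        gL E q - gV E p - 1 / 2 * (Z\<^sup>2 * (vV E p - vL E q)) * (vL E q + vV E p)"
      unfolding total_gibbs_def fst_conv snd_conv rel by (simp add: power2_eq_square field_simps)
    then show ?thesis unfolding qp[symmetric] by (simp add: Z_def flux_def h_def)
  qed
  then have kin: "kinetic_flux E (p, uV) (q, u) W = Z" by (simp add: kinetic_flux_def)
  \<comment> \<open>The kinetic relation makes the entropy production times \<open>tau E * p\<close>
    equal to \<open>Z^2\<close>, so entropy holds automatically.\<close>
  have "0 \<le> Z * Z" by simp
  also have "\<dots> = tau E * p * (Z * (total_gibbs (liquid E) (q, u) W - total_gibbs (vapor E) (p, uV) W))"
    using tg by (metis mult.left_commute)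
  finally have ent: "0 \<le> Z * (total_gibbs (liquid E) (q, u) W - total_gibbs (vapor E) (p, uV) W)"
    using mult_pos_neg[OF mult_pos_pos[OF tau_pos p],
        of "Z * (total_gibbs (liquid E) (q, u) W - total_gibbs (vapor E) (p, uV) W)"]
    by linarith
  have mom: "- Z * (u - uV) + (q - p) = 0"
    unfolding qp by (simp add: u_def power2_eq_square)
  have "boundary_VL E (p, uV) (q, u) W"
    using ip ent mom
    by (simp add: boundary_VL_def discontinuity_def Let_def admissible_flux_def Zs kin
        interface_pressure_def Z_def flux_def)
  then show ?thesis by (simp add: u_def W_def Z_def)
qed

lemma boundary_LV_states:
  assumes b: "boundary_LV E (q, u) (p, uV) W" and p: "0 < p" and q: "pmin E \<le> q"
  shows "interface_pressure E p q" "W = uV - flux p q * vV E p"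
    "u = uV - flux p q * (vV E p - vL E q)"
proof -
  have "boundary_VL E (p, - uV) (q, - u) (- W)"
    using b boundary_reflect[of E "(p, uV)" "(q, u)" W] by simp
  from boundary_VL_states[OF this p q] show "interface_pressure E p q"
    "W = uV - flux p q * vV E p" "u = uV - flux p q * (vV E p - vL E q)" by auto
qed

lemma boundary_LV_exists:
  assumes ip: "interface_pressure E p q" and p: "0 < p"
  shows "boundary_LV E (q, uV - flux p q * (vV E p - vL E q)) (p, uV) (uV - flux p q * vV E p)"
  using boundary_VL_exists[OF assms, of "- uV"]
    boundary_reflect[of E "(p, uV)" "(q, uV - flux p q * (vV E p - vL E q))" "uV - flux p q * vV E p"]
  by (simp add: algebra_simps)

section \<open>The outer liquid waves\<close>

lemma left_wave_only:
  assumes wv: "liquid_wave E (pl, ul) (q, u) x1 x2" and "x2 < u" "pmin E \<le> pl" "pmin E \<le> q"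
  shows "u = ul - liq.wave pl q"
proof -
  from wv consider "shock (liquid E) (pl, ul) (q, u) x2"
    | s where "s \<in> {-1, 1}" "rarefaction (liquid E) (pmin E) s (pl, ul) (q, u) x1 x2"
    unfolding liquid_wave_def by blast
  then show ?thesis
  proof cases
    case 1
    from liq.left_shock_only(2)[OF this] assms show ?thesis by simp
  next
    case 2
    note st = liq.fan_states[OF 2(2,1)]
    \<comment> \<open>A fan of this family would end at the speed \<open>u + a\<close>, to the right
      of \<open>u\<close>.\<close>
    have "s \<noteq> 1" using st(2) assms liq.a_pos[of q] by auto
    with 2 have s: "s = -1" by auto
    with st show ?thesis by (auto simp: liq.wave_def)
  qed
qed

lemma right_wave_only:
  assumes wv: "liquid_wave E (q, u) (pr, ur) x1 x2" and "u < x1" "pmin E \<le> pr" "pmin E \<le> q"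
  shows "u = ur + liq.wave pr q"
proof -
  from wv consider "shock (liquid E) (q, u) (pr, ur) x1"
    | s where "s \<in> {-1, 1}" "rarefaction (liquid E) (pmin E) s (q, u) (pr, ur) x1 x2"
    unfolding liquid_wave_def by blast
  then show ?thesis
  proof cases
    case 1
    from liq.right_shock_only(2)[OF this] assms show ?thesis by simp
  next
    case 2
    note st = liq.fan_states[OF 2(2,1)]
    have "s \<noteq> -1" using st(1) assms liq.a_pos[of q] by auto
    with 2 have s: "s = 1" by auto
    with st show ?thesis by (auto simp: liq.wave_def)
  qed
qed

text \<open>A chord of the liquid curve ending at \<open>phi E p\<close> is less steep than the chord from the vapor
  state, so the shock outruns the phase boundary.\<close>

lemma flux_lt_shock_flux:
  assumes p: "0 < p" "p < psat E" and pl: "pmin E \<le> pl" "pl < phi E p"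
  shows "flux p (phi E p) < liq.shock_flux pl (phi E p)"
proof -
  define q where "q = phi E p"
  have pr: "p \<in> vapor_range E \<alpha>" using p below_psat_in_range by simp
  note ev = phi_evaporation[OF p, folded q_def]
  note D = phi_facts(1,2)[OF p, folded q_def]
  have mp: "pmin E \<le> p" using p pmin_le by simp
  have dl: "0 < vL E pl - vL E q"
    using liq.v_strict_antimono[OF pl(1), of q] pl(2) by (simp add: q_def)
  have "(vL E pl - vL E q) / (q - pl) < (vV E p - vL E q) / (q - p)"
  proof (cases "pl \<le> p")
    case True
    have "(vL E pl - vL E q) / (q - pl) \<le> (vL E pl - vL E q) / (q - p)"
      using True ev dl by (intro divide_left_mono) auto
    also have "\<dots> < (vV E p - vL E q) / (q - p)"
      using ev volume_ratio(2)[OF pr pl(1)] by (intro divide_strict_right_mono) auto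
    finally show ?thesis .
  next
    case False
    then have "(vL E pl - vL E q) / (q - pl) \<le> (vL E p - vL E q) / (q - p)"
      using liq.chord_slope_antimono[OF mp, of pl q] pl by (simp add: q_def)
    also have "\<dots> < (vV E p - vL E q) / (q - p)"
      using ev volume_ratio(2)[OF pr mp] by (intro divide_strict_right_mono) auto
    finally show ?thesis .
  qed
  then have "(q - p) / (vV E p - vL E q) < (q - pl) / (vL E pl - vL E q)"
    using D(1) dl ev pl by (simp add: q_def divide_simps mult.commute)
  then have "(flux p q)\<^sup>2 < (q - pl) / (vL E pl - vL E q)"
    using D by simp
  then have "flux p q < sqrt ((q - pl) / (vL E pl - vL E q))"
    by (rule real_less_rsqrt)
  then show ?thesis by (simp add: q_def liq.shock_flux_def)
qed

text \<open>The speed \<open>u - flux p q * vL E q\<close> is that of the phase boundary. A shock is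
  faster by \<open>flux_lt_shock_flux\<close>; a fan ends at \<open>u - a\<close>, which lies to the
  left because the liquid flow is subsonic relative to the boundary.\<close>

lemma left_wave_exists:
  fixes p pl ul :: real
  assumes p: "0 < p" "p < psat E" and pl: "pmin E \<le> pl"
  defines "q \<equiv> phi E p" and "u \<equiv> ul - liq.wave pl (phi E p)"
  obtains x1 x2 where "liquid_wave E (pl, ul) (q, u) x1 x2" "x2 < u - flux p q * vL E q"
proof -
  note ev = phi_evaporation[OF p, folded q_def]
  have mq: "pmin E < q" using ev p pmin_le by simp
  have v: "0 < vL E q" and b: "0 < aL E q" using liq.v_pos liq.a_pos mq by auto
  show thesis
  proof (cases "pl < q")
    case True
    have "liquid_wave E (pl, ul) (q, u) (u - liq.shock_flux pl q * vL E q)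
        (u - liq.shock_flux pl q * vL E q)"
      using liq.left_shock[OF pl True] by (auto simp: liquid_wave_def u_def q_def)
    moreover have "flux p q * vL E q < liq.shock_flux pl q * vL E q"
      using flux_lt_shock_flux[OF p pl] True v by (simp add: q_def)
    ultimately show thesis using that by (metis diff_strict_left_mono)
  next
    case False
    have "liquid_wave E (pl, ul) (q, u) (ul + - 1 * aL E pl) (u + - 1 * aL E q)"
    proof -
      have "u = ul + - 1 * (liq.riemann q - liq.riemann pl)"
        using False by (simp add: u_def q_def liq.wave_def)
      then show ?thesis
        using liq.fan_exists[of "-1" pl q ul] False mq unfolding liquid_wave_def by auto
    qed
    moreover have "u + - 1 * aL E q < u - flux p q * vL E q"
      using ev v b by (simp add: liq.admittance_def field_simps)
    ultimately show thesis by (rule that)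
  qed
qed

lemma right_wave_exists:
  fixes p pr ur :: real
  assumes p: "0 < p" "p < psat E" and pr: "pmin E \<le> pr"
  defines "q \<equiv> phi E p" and "u \<equiv> ur + liq.wave pr (phi E p)"
  obtains x1 x2 where "liquid_wave E (q, u) (pr, ur) x1 x2" "u + flux p q * vL E q < x1"
proof -
  note ev = phi_evaporation[OF p, folded q_def]
  have mq: "pmin E < q" using ev p pmin_le by simp
  have v: "0 < vL E q" and b: "0 < aL E q" using liq.v_pos liq.a_pos mq by auto
  show thesis
  proof (cases "pr < q")
    case True
    have "liquid_wave E (q, u) (pr, ur) (u + liq.shock_flux pr q * vL E q)
        (u + liq.shock_flux pr q * vL E q)"
      using liq.right_shock[OF pr True] by (auto simp: liquid_wave_def u_def q_def)
    moreover have "flux p q * vL E q < liq.shock_flux pr q * vL E q"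
      using flux_lt_shock_flux[OF p pr] True v by (simp add: q_def)
    ultimately show thesis using that by (metis add_strict_left_mono)
  next
    case False
    have "liquid_wave E (q, u) (pr, ur) (u + 1 * aL E q) (ur + 1 * aL E pr)"
    proof -
      have "ur = u + 1 * (liq.riemann pr - liq.riemann q)"
        using False by (simp add: u_def q_def liq.wave_def)
      then show ?thesis
        using liq.fan_exists[of 1 q pr u] False mq unfolding liquid_wave_def by auto
    qed
    moreover have "u + flux p q * vL E q < u + 1 * aL E q"
      using ev v b by (simp add: liq.admittance_def field_simps)
    ultimately show thesis by (rule that)
  qed
qed

section \<open>Solutions with a vapor layer\<close>

lemma phase_transition_solution_exists:
  assumes p: "0 < p" "p < psat E" and W: "pmin E \<le> pl" "pmin E \<le> pr"
    and root: "f_z E p (pl, ul) (pr, ur) = 0"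
  shows "\<exists>uV. phase_transition_solution E (pl, ul) (pr, ur) p uV"
proof -
  define q where "q = phi E p"
  define z where "z = flux p q"
  have pV: "p \<in> vapor_range E \<alpha>" using p below_psat_in_range by simp
  note ev = phi_evaporation[OF p, folded q_def, folded z_def]
  have mq: "pmin E \<le> q" using ev p pmin_le by simp
  have w: "0 < vV E p" using vapor_facts[OF p(1)] by simp
  \<comment> \<open>Both boundaries carry the same flux magnitude, so the liquid velocities lie
    symmetrically about the vapor velocity. With the mean as \<open>uV\<close>, the two jump
    relations become the single equation \<open>f_z = 0\<close>.\<close>
  define u1 u2 uV where "u1 = ul - liq.wave pl q" and "u2 = ur + liq.wave pr q"
    and "uV = (u1 + u2) / 2"
  have "u2 - u1 = 2 * z * (vV E p - vL E q)"
    using root mq W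
    by (simp add: f_z_eq cav_fun_def wave_fun_eq zflux_eq u1_def u2_def q_def z_def)
  then have u: "u1 = uV - z * (vV E p - vL E q)" "u2 = uV + z * (vV E p - vL E q)"
    by (auto simp: uV_def field_simps)
  note ip = phi_interface[OF pV, folded q_def]
  obtain x1 x2 where left: "liquid_wave E (pl, ul) (q, u1) x1 x2" "x2 < u1 - z * vL E q"
    using left_wave_exists[OF p W(1)] unfolding q_def z_def u1_def .
  obtain x3 x4 where right: "liquid_wave E (q, u2) (pr, ur) x3 x4" "u2 + z * vL E q < x3"
    using right_wave_exists[OF p W(2)] unfolding q_def z_def u2_def .
  have "boundary_LV E (q, u1) (p, uV) (uV - z * vV E p)"
    using boundary_LV_exists[OF ip p(1)] u by (simp add: z_def)
  moreover have "boundary_VL E (p, uV) (q, u2) (uV + z * vV E p)"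
    using boundary_VL_exists[OF ip p(1)] u by (simp add: z_def)
  moreover have "x2 < uV - z * vV E p" "uV + z * vV E p < x3"
    using left(2) right(2) u by (simp_all add: algebra_simps)
  moreover have "uV - z * vV E p < uV + z * vV E p"
    using mult_pos_pos[OF ev(2) w] by simp
  ultimately have "phase_transition_solution E (pl, ul) (pr, ur) p uV"
    unfolding phase_transition_solution_def using left(1) right(1) mq p(1)
    by - (rule conjI[OF p(1)], rule exI[of _ "(q, u1)"], rule exI[of _ "(q, u2)"],
        rule exI[of _ x1], rule exI[of _ x2], rule exI[of _ "uV - z * vV E p"],
        rule exI[of _ "uV + z * vV E p"], rule exI[of _ x3], rule exI[of _ x4], simp)
  then show ?thesis by blast
qed

lemma phase_transition_solution_facts:
  assumes sol: "phase_transition_solution E (pl, ul) (pr, ur) p uV"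
    and p: "p \<in> vapor_range E \<alpha>" and W: "pmin E \<le> pl" "pmin E \<le> pr"
  shows "f_z E p (pl, ul) (pr, ur) = 0"
    "uV = 1 / 2 * (ur + ul) + 1 / 2 * (f_side E p (pr, ur) - f_side E p (pl, ul))"
proof -
  from sol obtain q1 u1 q2 u2 x1 x2 W1 W2 x3 x4 where
    q: "pmin E \<le> q1" "pmin E \<le> q2" and ord: "x2 < W1" "W1 < W2" "W2 < x3" and
    waves: "liquid_wave E (pl, ul) (q1, u1) x1 x2" "liquid_wave E (q2, u2) (pr, ur) x3 x4" and
    LV: "boundary_LV E (q1, u1) (p, uV) W1" and VL: "boundary_VL E (p, uV) (q2, u2) W2"
    unfolding phase_transition_solution_def by auto
  have pp: "0 < p" using p range_pos by simp
  define q where "q = phi E p"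
  define z where "z = flux p q"
  note LV' = boundary_LV_states[OF LV pp q(1)] and VL' = boundary_VL_states[OF VL pp q(2)]
  have qs: "q1 = q" "q2 = q"
    using phi_eq[OF p] LV'(1) VL'(1) by (auto simp: q_def)
  have st: "W1 = uV - z * vV E p" "u1 = uV - z * (vV E p - vL E q)"
    "W2 = uV + z * vV E p" "u2 = uV + z * (vV E p - vL E q)"
    using LV' VL' by (auto simp: qs z_def)
  have mq: "pmin E \<le> q" using q qs by simp
  \<comment> \<open>\<open>W1 < W2\<close> forces evaporation. The boundaries then move into the
    liquid, with \<open>W1 < u1\<close> and \<open>u2 < W2\<close>, so the outer waves are of the
    expected families.\<close>
  have "0 < z * vV E p" using ord(2) st by simp
  then have z: "0 < z" using vapor_facts(1)[OF pp] by (simp add: zero_less_mult_iff)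
  have zv: "0 < z * vL E q" using z liq.v_pos[OF mq] by simp
  have "x2 < u1" using ord(1) st zv by (simp add: algebra_simps)
  then have u1: "u1 = ul - liq.wave pl q"
    using left_wave_only[OF waves(1)] W mq qs by simp
  have "u2 < x3" using ord(3) st zv by (simp add: algebra_simps)
  then have u2: "u2 = ur + liq.wave pr q"
    using right_wave_only[OF waves(2)] W mq qs by simp
  have "u2 - u1 = 2 * z * (vV E p - vL E q)" using st by simp
  then show "f_z E p (pl, ul) (pr, ur) = 0"
    using mq W by (simp add: f_z_eq cav_fun_def wave_fun_eq zflux_eq u1 u2 q_def z_def)
  have "uV = (u1 + u2) / 2" using st by simp
  then show "uV = 1 / 2 * (ur + ul) + 1 / 2 * (f_side E p (pr, ur) - f_side E p (pl, ul))"
    using mq W by (simp add: f_side_def wave_fun_eq u1 u2 q_def field_simps)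
qed

end

theorem theorem5p15:
  fixes E :: two_phase and \<alpha> \<beta> pLm uLm pLp uLp pstar :: real and WLm WLp :: state
  assumes fluid: "two_phase_fluid E"
    and bounds: "constitutive_bounds E \<alpha> \<beta>"
    and phi_well_defined: "\<forall>p\<in>vapor_range E \<alpha>. \<exists>!q. interface_pressure E p q"
    and left_state: "WLm = (pLm, uLm)" "pmin E \<le> pLm"
    and right_state: "WLp = (pLp, uLp)" "pmin E \<le> pLp"
    and cavitation: "cavitation_criterion E WLm WLp"
    and root: "pstar \<in> vapor_range E \<alpha>" "pmin E \<le> pstar" "f_z E pstar WLm WLp = 0"
  shows "(\<forall>p\<in>vapor_range E \<alpha>. pmin E \<le> p \<and> f_z E p WLm WLp = 0 \<longrightarrow> p = pstar) \<and>
    (\<exists>uV. phase_transition_solution E WLm WLp pstar uV) \<and>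
    (\<forall>pV\<in>vapor_range E \<alpha>. \<forall>uV. phase_transition_solution E WLm WLp pV uV \<longrightarrow>
       pV = pstar \<and>
       uV = 1 / 2 * (uLp + uLm) + 1 / 2 * (f_side E pstar WLp - f_side E pstar WLm))"
proof -
  interpret two_phase_setting E \<alpha> \<beta>
    by standard (use fluid bounds phi_well_defined in auto)
  have W: "pmin E \<le> fst WLm" "pmin E \<le> fst WLp"
    using left_state right_state by auto
  have unique: "p = pstar" if "p \<in> vapor_range E \<alpha>" "f_z E p WLm WLp = 0" for p
    using root_unique[OF cavitation W that root(1,3)] .
  have "\<exists>uV. phase_transition_solution E WLm WLp pstar uV"
    using phase_transition_solution_exists[of pstar pLm pLp uLm uLp] left_state right_state
      range_pos[OF root(1)] root_below_psat[OF cavitation W root(1,3)] root(3) by simp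
  moreover have "pV = pstar \<and>
      uV = 1 / 2 * (uLp + uLm) + 1 / 2 * (f_side E pstar WLp - f_side E pstar WLm)"
    if "pV \<in> vapor_range E \<alpha>" "phase_transition_solution E WLm WLp pV uV" for pV uV
    using phase_transition_solution_facts[of pLm uLm pLp uLp pV uV] that unique left_state right_state
    by auto
  ultimately show ?thesis using unique by blast
qed

end
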